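(* Let $\mathscr{B}\subset\mathbb{N}\setminus\{1\}$ be taut. Then either $\mathrm{Aut}(\{0,1\}^{\mathbb{Z}})$ embeds into $\mathrm{Aut}(\widetilde{X_{\eta_{\mathscr{B}}}})$ (i.e. there is an injective group homomorphism $\mathrm{Aut}(\{0,1\}^{\mathbb{Z}})\to\mathrm{Aut}(\widetilde{X_{\eta_{\mathscr{B}}}})$), or $\mathrm{Aut}(\widetilde{X_{\eta_{\mathscr{B}}}})$ is trivial.
   Context: A subshift is a closed subset $X\subseteq\{0,1\}^{\mathbb{Z}}$ invariant under the left shift $\sigma$, $(\sigma x)[n]=x[n+1]$. $\mathrm{Aut}(X)$ is the group, under composition, of all homeomorphisms $X\to X$ commuting with $\sigma$; it is called trivial if it equals $\{\sigma^n:n\in\mathbb{Z}\}$. For $\mathscr{B}\subset\mathbb{N}$ let $\mathcal{M}_{\mathscr{B}}=\bigcup_{b\in\mathscr{B}}b\mathbb{Z}$, $\mathcal{F}_{\mathscr{B}}=\mathbb{Z}\setminus\mathcal{M}_{\mathscr{B}}$ and let $\eta_{\mathscr{B}}\in\{0,1\}^{\mathbb{Z}}$ be the characteristic function of $\mathcal{F}_{\mathscr{B}}$. The $\mathscr{B}$-free subshift $X_{\eta_{\mathscr{B}}}$ is the orbit closure $\overline{\{\sigma^n\eta_{\mathscr{B}}:n\in\mathbb{Z}\}}$. The hereditary closure of a subshift $X$ is $\widetilde{X}=\{y\in\{0,1\}^{\mathbb{Z}}:\exists x\in X,\ y\preccurlyeq x\}$, where $\preccurlyeq$ means coordinatewise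 less than or equal to. $\mathscr{B}$ is taut if for every $b\in\mathscr{B}$ one has $\boldsymbol{\delta}(\mathcal{M}_{\mathscr{B}\setminus\{b\}})<\boldsymbol{\delta}(\mathcal{M}_{\mathscr{B}})$, where $\boldsymbol{\delta}(A)=\lim_{N\to\infty}\frac{1}{\log N}\sum_{a\in A,\,1\le a\le N}\frac1a$ is the logarithmic density (which exists for all sets of multiples). *)

theory Defs
  imports "HOL-Analysis.Analysis" "HOL-Algebra.Bij"
begin

text \<open>
  A point of the full shift is a function of type \<^typ>\<open>int \<Rightarrow> bool\<close>, with \<^const>\<open>True\<close> for the symbol 1.
  The library topology on this type is the product of the discrete topologies on \<^typ>\<open>bool\<close>, and
  the library order on it is the coordinatewise one (with \<^prop>\<open>False \<le> True\<close>).
\<close>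

type_synonym point = "int \<Rightarrow> bool"

definition shift :: "int \<Rightarrow> point \<Rightarrow> point" where
  "shift n x = (\<lambda>k. x (k + n))"

abbreviation left_shift :: "point \<Rightarrow> point" ("\<sigma>") where
  "\<sigma> \<equiv> shift 1"

text \<open>The next three facts identify \<^term>\<open>shift n\<close> with the integer power \<open>\<sigma>\<^sup>n\<close>.\<close>

lemma shift_0: "shift 0 = id"
  by (simp add: shift_def fun_eq_iff)

lemma shift_comp: "shift m \<circ> shift n = shift (m + n)"
  by (simp add: shift_def fun_eq_iff algebra_simps)

lemma shift_of_nat: "shift (int n) = \<sigma> ^^ n"
proof (induction n)
  case (Suc n)
  then show ?case using shift_comp[of 1 "int n"] by simp
qed (simp add: shift_0)

text \<open>
  As in \<^const>\<open>BijGroup\<close>, self-maps of \<open>X\<close> are represented by functions that are extensional on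
  \<open>X\<close>, so that two automorphisms are equal iff they agree on \<open>X\<close>. The condition
  of commuting with \<open>\<sigma>\<close> is only meaningful for shift-invariant \<open>X\<close>.
\<close>

definition Aut :: "point set \<Rightarrow> (point \<Rightarrow> point) monoid" where
  "Aut X = (BijGroup X)
     \<lparr>carrier := {f \<in> Bij X. homeomorphic_map (top_of_set X) (top_of_set X) f \<and>
                              (\<forall>x\<in>X. f (\<sigma> x) = \<sigma> (f x))}\<rparr>"

definition trivial_Aut :: "point set \<Rightarrow> bool" where
  "trivial_Aut X \<longleftrightarrow> carrier (Aut X) = range (\<lambda>n. restrict (shift n) X)"

definition multiples :: "nat set \<Rightarrow> int set" where
  "multiples B = (\<Union>b\<in>B. range (\<lambda>k. int b * k))"

definition free_numbers :: "nat set \<Rightarrow> int set" where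
  "free_numbers B = UNIV - multiples B"

definition eta :: "nat set \<Rightarrow> point" where
  "eta B = (\<lambda>k. k \<in> free_numbers B)"

definition B_free_subshift :: "nat set \<Rightarrow> point set" where
  "B_free_subshift B = closure (range (\<lambda>n. shift n (eta B)))"

definition hereditary_closure :: "point set \<Rightarrow> point set" where
  "hereditary_closure X = {y. \<exists>x\<in>X. y \<le> x}"

text \<open>
  For an arbitrary set of integers the limit need not exist; for sets of multiples, to which
  this is applied below, it does (Davenport and Erdos).
\<close>

definition log_density :: "int set \<Rightarrow> real" where
  "log_density A = lim (\<lambda>N::nat. (1 / ln (real N)) * (\<Sum>a\<in>{a \<in> A. 1 \<le> a \<and> a \<le> int N}. 1 / real_of_int a))"

definition taut :: "nat set \<Rightarrow> bool" where
  "taut B \<longleftrightarrow> (\<forall>b\<in>B. log_density (multiples (B - {b})) < log_density (multiples B))"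

lemma group_Aut:
  assumes "\<sigma> ` X \<subseteq> X"
  shows "group (Aut X)"
proof -
  interpret B: group "BijGroup X" by (rule group_BijGroup)
  let ?H = "carrier (Aut X)"
  have H: "f \<in> ?H \<longleftrightarrow> f \<in> Bij X \<and> homeomorphic_map (top_of_set X) (top_of_set X) f \<and>
              (\<forall>x\<in>X. f (\<sigma> x) = \<sigma> (f x))" for f
    by (simp add: Aut_def)
  have hom_cong: "homeomorphic_map (top_of_set X) (top_of_set X) g"
    if "homeomorphic_map (top_of_set X) (top_of_set X) f" "\<And>x. x \<in> X \<Longrightarrow> f x = g x" for f g
    using that by (auto intro: homeomorphic_map_eq)
  have sX: "\<sigma> x \<in> X" if "x \<in> X" for x using assms that by auto
  have "subgroup ?H (BijGroup X)"
  proof (rule B.subgroupI)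
    show "?H \<subseteq> carrier (BijGroup X)" by (auto simp: H BijGroup_def)
    have "(\<lambda>x\<in>X. x) \<in> ?H"
      using hom_cong[of id "\<lambda>x\<in>X. x"] by (auto simp: H id_Bij sX homeomorphic_map_id)
    then show "?H \<noteq> {}" by blast
  next
    fix f assume f: "f \<in> ?H"
    then have fB: "f \<in> Bij X" and bij: "bij_betw f X X" by (auto simp: H Bij_def)
    obtain g where g: "homeomorphic_maps (top_of_set X) (top_of_set X) f g"
      using f by (auto simp: H homeomorphic_map_maps)
    have gX: "g x \<in> X" "f (g x) = x" "g (f x) = x" if "x \<in> X" for x
      using g that by (auto simp: homeomorphic_maps_def continuous_map_def)
    let ?i = "\<lambda>x\<in>X. inv_into X f x"
    have ig: "inv_into X f x = g x" if "x \<in> X" for x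
      using bij gX[OF that] by (metis bij_betw_inv_into_left)
    have "homeomorphic_map (top_of_set X) (top_of_set X) ?i"
    proof (rule hom_cong)
      show "homeomorphic_map (top_of_set X) (top_of_set X) g"
        using g homeomorphic_maps_sym homeomorphic_map_maps by blast
    qed (simp add: ig)
    moreover have "?i (\<sigma> x) = \<sigma> (?i x)" if "x \<in> X" for x
    proof -
      have "g (\<sigma> x) = g (f (\<sigma> (g x)))" using f gX[OF that] by (simp add: H)
      then show ?thesis using gX that sX by (simp add: ig)
    qed
    ultimately have "?i \<in> ?H" using fB by (simp add: H restrict_inv_into_Bij)
    then show "inv\<^bsub>BijGroup X\<^esub> f \<in> ?H" using fB by (simp add: inv_BijGroup)
  next
    fix f g assume fg: "f \<in> ?H" "g \<in> ?H"
    have gX: "g x \<in> X" if "x \<in> X" for x using fg that by (auto simp: H Bij_def bij_betw_def)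
    have "homeomorphic_map (top_of_set X) (top_of_set X) (compose X f g)"
    proof (rule hom_cong)
      show "homeomorphic_map (top_of_set X) (top_of_set X) (f \<circ> g)"
        using fg homeomorphic_map_compose by (meson H)
    qed (simp add: compose_def)
    then have "compose X f g \<in> ?H"
      using fg gX sX by (simp add: H compose_Bij) (simp add: compose_def)
    then show "f \<otimes>\<^bsub>BijGroup X\<^esub> g \<in> ?H" using fg by (auto simp: H BijGroup_def)
  qed
  then have "group ((BijGroup X)\<lparr>carrier := ?H\<rparr>)" by (rule B.subgroup_imp_group)
  then show ?thesis by (simp add: Aut_def)
qed

end

theory Submission
  imports Defs "HOL-Number_Theory.Totient"
begin

text \<open>
  Write \<open>Y\<close> for the hereditary closure and \<open>F\<close> for the set of \<open>B\<close>-free integers. By compactness,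
  \<open>x\<close> lies in \<open>Y\<close> iff every finite subset of its support is \<open>freeable\<close>, that is, has a
  translate inside \<open>F\<close> (\<open>hereditary_closure_iff\<close>). The two alternatives are separated by the
  question whether some \<open>d > 0\<close> has a factor in common with every element of \<open>B\<close>.

  Suppose that such a \<open>d\<close> exists. Then the class \<open>1 + d\<int>\<close> lies in \<open>F\<close>, since a common divisor of
  \<open>b\<close> and \<open>d\<close> that divides a number of this class divides \<open>1\<close>. Moreover there is a length \<open>K\<close>
  such that \<open>K\<close> consecutive terms of a class modulo \<open>d\<close> lie in \<open>F\<close> only if the whole class does
  (\<open>long_run_gives_free_class\<close>). A run of \<open>K\<close> ones with step \<open>d\<close> in \<open>x \<in> Y\<close> therefore certifies
  that \<open>x\<close> may be overwritten freely on that residue class. Using such runs as markers, each class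
  carries cells with two data bits each. A maximal chain of neighbouring cells is read as a
  conveyor belt: along the first bits in one direction, back along the second bits. The belt shows
  a point of the full shift, which is periodic if the chain is finite, and an automorphism of the
  full shift acts on all belts at once. This action is faithful, because a bi-infinite chain
  displays any prescribed point (\<open>Aut_full_shift_embeds\<close>).

  Suppose that no such \<open>d\<close> exists. Then \<open>Y\<close> is rigid, for two arithmetic reasons.
  Every nonzero class modulo \<open>b \<in> B\<close> contains infinitely many free numbers
  (\<open>free_numbers_residue_class\<close>); and if \<open>A \<subseteq> F\<close> is finite and \<open>\<alpha> \<notin> A\<close>, then some translation
  by \<open>n\<close> keeps \<open>A\<close> inside \<open>F\<close> and moves \<open>\<alpha>\<close> to a multiple of some \<open>b \<in> B\<close>
  (\<open>simultaneously_free\<close>). Let \<open>f\<close> be an automorphism. It fixes the zero point and has a finite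
  window, so it acts separately on parts of a point that are far apart. Adjoin to \<open>A\<close> a remote and
  sparse set \<open>C\<close> which, after the translation by \<open>n\<close>, consists of free numbers that represent all
  nonzero classes modulo \<open>b\<close>. The translates that make \<open>C\<close> free are then known modulo \<open>b\<close>, and
  they make \<open>\<alpha>\<close> a multiple of \<open>b\<close>. Hence \<open>A \<union> C\<close> is freeable while \<open>{\<alpha>} \<union> C\<close> is not. If the
  image of a single one had two ones, or if the image of a finite point had a one outside the
  translated support, the same kind of set would be mapped from freeable to not freeable. So \<open>f\<close>
  agrees with a shift on points of finite support, which are dense.

  Both arithmetic facts say that a free pattern recurs in prescribed arithmetic progressions
  (\<open>free_pattern_recurrence\<close>), and this is where tautness enters. For a pattern in a suitable
  progression only divisors without small prime factors are dangerous. If these were not sparse,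
  one could choose infinitely many independent blocks of them, the multiples of some set
  \<open>{e. g * e \<in> B}\<close> would have density one, and removing one element of \<open>B\<close> would not change the
  logarithmic density (\<open>taut_rough_cofactors\<close>). That finitely many divisors control infinitely many
  of them is the theorem of Davenport and Erdos. It is used in the form of an inequality that holds
  for every \<open>N\<close> (\<open>logsum_avoids_ge\<close>): both "\<open>n\<close> is free of \<open>D\<close>" and "\<open>n \<le> N\<close>" are inherited by
  divisors, so they are positively correlated by the inequality of Harris.
\<close>

section \<open>Points, shift-commuting maps and the hereditary closure\<close>

lemma open_coordinate_set: "open {x :: point. x k = v}"
proof -
  have "{x :: point. x k = v} = (\<lambda>x. x k) -` {v}" by auto
  moreover have "open ((\<lambda>x::point. x k) -` {v})"
    by (intro open_vimage continuous_on_product_coordinates open_discrete)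
  ultimately show ?thesis by simp
qed

lemma coordinate_locally_constant: "eventually (\<lambda>y :: point. y k = x k) (nhds x)"
  using open_coordinate_set[of k "x k"] by (auto simp: eventually_nhds)

text \<open>
  Cylinders over symmetric windows form a neighbourhood basis of a point.
\<close>

lemma window_neighbourhood:
  assumes "eventually P (nhds (x :: point))"
  shows "\<exists>r\<ge>0. \<forall>y. (\<forall>k. \<bar>k\<bar> \<le> r \<longrightarrow> y k = x k) \<longrightarrow> P y"
proof -
  obtain U where U: "open U" "x \<in> U" "\<And>y. y \<in> U \<Longrightarrow> P y"
    using assms by (auto simp: eventually_nhds)
  have "openin (product_topology (\<lambda>i::int. euclidean :: bool topology) UNIV) U"
    using U(1) by (simp add: euclidean_product_topology)
  then obtain V where V: "finite {i. V i \<noteq> UNIV}" "x \<in> Pi\<^sub>E UNIV V" "Pi\<^sub>E UNIV V \<subseteq> U"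
    using U(2) by (force simp: openin_product_topology_alt)
  define r where "r = Max (insert 0 (abs ` {i. V i \<noteq> UNIV}))"
  show ?thesis
  proof (intro exI[of _ r] conjI allI impI)
    show "r \<ge> 0" unfolding r_def using V(1) by simp
    fix y :: point assume y: "\<forall>k. \<bar>k\<bar> \<le> r \<longrightarrow> y k = x k"
    have "y i \<in> V i" for i
    proof (cases "V i = UNIV")
      case False
      then have "\<bar>i\<bar> \<le> r" unfolding r_def using V(1) by simp
      then show ?thesis using y V(2) by (auto simp: PiE_iff)
    qed simp
    then show "P y" using V(3) U(3) by (auto simp: PiE_iff)
  qed
qed

text \<open>
  Convergence is coordinatewise, and in a discrete space a function converges iff it is eventually
  constant. Continuity questions thus become statements about locally constant coordinates.
\<close>

lemma tendsto_point_iff: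
  "filterlim f (nhds (l :: point)) F \<longleftrightarrow> (\<forall>k. eventually (\<lambda>y. f y k = l k) F)"
proof -
  have "filterlim f (nhds l) F \<longleftrightarrow> limitin (product_topology (\<lambda>i::int. euclidean :: bool topology) UNIV) f l F"
    by (simp add: euclidean_product_topology)
  also have "\<dots> \<longleftrightarrow> (\<forall>k. ((\<lambda>y. f y k) \<longlongrightarrow> l k) F)"
    by (simp add: limitin_componentwise)
  also have "\<dots> \<longleftrightarrow> (\<forall>k. eventually (\<lambda>y. f y k = l k) F)"
    by (simp add: tendsto_discrete)
  finally show ?thesis .
qed

lemma continuous_on_point_iff:
  "continuous_on X (f :: point \<Rightarrow> point) \<longleftrightarrow>
     (\<forall>x\<in>X. \<forall>k. eventually (\<lambda>y. f y k = f x k) (at x within X))"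
  by (simp add: continuous_on_def tendsto_point_iff)

lemma compact_point_space: "compact (UNIV :: point set)"
proof -
  have "compact_space (product_topology (\<lambda>i::int. euclidean :: bool topology) UNIV)"
    unfolding compact_space_product_topology
    by (auto simp: compact_space_def finite_imp_compact)
  then show ?thesis by (simp add: euclidean_product_topology compact_space_def)
qed

lemma shift_shift [simp]: "shift m (shift n x) = shift (m + n) x"
  using shift_comp[of m n] by (simp add: fun_eq_iff)

lemma shift_apply: "shift n x k = x (k + n)"
  by (simp add: shift_def)

lemma shift_zero [simp]: "shift 0 x = x"
  by (simp add: shift_def)

lemma continuous_on_shift: "continuous_on X (shift n)"
proof -
  have "eventually (\<lambda>y. shift n y k = shift n x k) (at x within X)" for x k
    using coordinate_locally_constant[of "k + n" x] by (auto simp: shift_apply eventually_at_filter elim: eventually_mono)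
  then show ?thesis by (simp add: continuous_on_point_iff)
qed

lemma mem_multiples_iff: "x \<in> multiples B \<longleftrightarrow> (\<exists>b\<in>B. int b dvd x)"
  by (auto simp: multiples_def dvd_def)

definition freeable :: "nat set \<Rightarrow> int set \<Rightarrow> bool" where
  "freeable B A \<longleftrightarrow> (\<exists>n. \<forall>a\<in>A. a + n \<in> free_numbers B)"

text \<open>
  Freeability of the finite subsets of the support gives, for each finite window, a shift of
  \<^term>\<open>eta B\<close> that dominates \<open>x\<close> on that window. Compactness of the orbit closure turns these into a single dominating point.
\<close>

lemma hereditary_closure_iff:
  "x \<in> hereditary_closure (B_free_subshift B) \<longleftrightarrow>
     (\<forall>A. finite A \<longrightarrow> A \<subseteq> {k. x k} \<longrightarrow> freeable B A)"
proof
  assume "x \<in> hereditary_closure (B_free_subshift B)"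
  then obtain z where z: "z \<in> closure (range (\<lambda>n. shift n (eta B)))" "x \<le> z"
    by (auto simp: hereditary_closure_def B_free_subshift_def)
  show "\<forall>A. finite A \<longrightarrow> A \<subseteq> {k. x k} \<longrightarrow> freeable B A"
  proof (intro allI impI)
    fix A assume A: "finite A" "A \<subseteq> {k. x k}"
    have "eventually (\<lambda>y. \<forall>a\<in>A. y a = z a) (nhds z)"
      using A(1) by (intro eventually_ball_finite ballI coordinate_locally_constant)
    then obtain U where U: "open U" "z \<in> U" "\<And>y a. y \<in> U \<Longrightarrow> a \<in> A \<Longrightarrow> y a = z a"
      by (auto simp: eventually_nhds)
    then obtain n where "shift n (eta B) \<in> U"
      using z(1) open_Int_closure_eq_empty[OF U(1), of "range (\<lambda>n. shift n (eta B))"] by blast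
    moreover have "z a" if "a \<in> A" for a
      using z(2) A(2) that by (auto simp: le_fun_def)
    ultimately have "shift n (eta B) a" if "a \<in> A" for a
      using U(3) that by blast
    then have "\<forall>a\<in>A. a + n \<in> free_numbers B"
      by (auto simp: shift_apply eta_def)
    then show "freeable B A" by (auto simp: freeable_def)
  qed
next
  assume *: "\<forall>A. finite A \<longrightarrow> A \<subseteq> {k. x k} \<longrightarrow> freeable B A"
  let ?X = "B_free_subshift B"
  define T where "T k = {y :: point. y k \<ge> x k}" for k
  have clT: "closed (T k)" for k
  proof -
    have "T k = - (if x k then {y. y k = False} else {})" by (auto simp: T_def)
    then show ?thesis using open_coordinate_set[of k False] by (auto simp: closed_def)
  qed
  have "?X \<inter> \<Inter>(range T) \<noteq> {}"
  proof (rule compact_imp_fip)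
    show "compact ?X"
      using compact_point_space by (metis B_free_subshift_def closed_closure compact_Int_closed inf_top_left)
  next
    fix F' assume F': "finite F'" "F' \<subseteq> range T"
    then obtain K where K: "finite K" "F' = T ` K" by (meson finite_subset_image)
    obtain n where n: "\<forall>a\<in>{k\<in>K. x k}. a + n \<in> free_numbers B"
      using *[rule_format, of "{k\<in>K. x k}"] K(1) by (auto simp: freeable_def)
    have "shift n (eta B) \<in> ?X" 
      unfolding B_free_subshift_def by (intro subsetD[OF closure_subset]) auto
    moreover have "shift n (eta B) \<in> \<Inter>F'"
      using n K(2) by (auto simp: T_def shift_apply eta_def)
    ultimately show "?X \<inter> \<Inter>F' \<noteq> {}" by blast
  qed (use clT in auto)
  then obtain y where "y \<in> ?X" "\<And>k. x k \<le> y k" by (auto simp: T_def)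
  then show "x \<in> hereditary_closure ?X"
    by (auto simp: hereditary_closure_def le_fun_def)
qed

lemma hereditary_closure_shift:
  assumes "x \<in> hereditary_closure (B_free_subshift B)"
  shows "shift n x \<in> hereditary_closure (B_free_subshift B)"
  unfolding hereditary_closure_iff
proof (intro allI impI)
  fix A assume A: "finite A" "A \<subseteq> {k. shift n x k}"
  then have "freeable B ((\<lambda>a. a + n) ` A)"
    using assms by (auto simp: hereditary_closure_iff shift_apply image_subset_iff)
  then obtain m where "\<forall>a\<in>A. a + n + m \<in> free_numbers B" by (auto simp: freeable_def)
  then show "freeable B A" unfolding freeable_def by (intro exI[of _ "n + m"]) (simp add: algebra_simps)
qed

lemma hereditary_closure_mono:
  assumes "x \<in> hereditary_closure (B_free_subshift B)" "\<And>k. y k \<Longrightarrow> x k"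
  shows "y \<in> hereditary_closure (B_free_subshift B)"
  using assms by (auto simp: hereditary_closure_iff)

lemma closed_hereditary_closure: "closed (hereditary_closure (B_free_subshift B))"
proof -
  have "\<exists>U. open U \<and> x \<in> U \<and> U \<subseteq> - hereditary_closure (B_free_subshift B)"
    if "x \<in> - hereditary_closure (B_free_subshift B)" for x
  proof -
    from that obtain A where A: "finite A" "A \<subseteq> {k. x k}" "\<not> freeable B A"
      by (auto simp: hereditary_closure_iff)
    then have "eventually (\<lambda>y. \<forall>a\<in>A. y a = x a) (nhds x)"
      by (intro eventually_ball_finite ballI coordinate_locally_constant) auto
    then obtain U where U: "open U" "x \<in> U" "\<And>y a. y \<in> U \<Longrightarrow> a \<in> A \<Longrightarrow> y a = x a"
      by (auto simp: eventually_nhds)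
    have "U \<subseteq> - hereditary_closure (B_free_subshift B)"
      using U(3) A by (force simp: hereditary_closure_iff)
    then show ?thesis using U by blast
  qed
  then show ?thesis by (simp add: closed_def open_subopen[of "- _"])
qed

lemma compact_hereditary_closure: "compact (hereditary_closure (B_free_subshift B))"
  using compact_point_space closed_hereditary_closure by (metis compact_Int_closed inf_top_left)

lemma carrier_Aut_I:
  assumes "\<And>x. x \<in> X \<Longrightarrow> f x \<in> X" "\<And>x. x \<in> X \<Longrightarrow> g x \<in> X"
    and "\<And>x. x \<in> X \<Longrightarrow> g (f x) = x" "\<And>x. x \<in> X \<Longrightarrow> f (g x) = x"
    and "continuous_on X f" "continuous_on X g"
    and "\<And>x. x \<in> X \<Longrightarrow> \<sigma> x \<in> X" "\<And>x. x \<in> X \<Longrightarrow> f (\<sigma> x) = \<sigma> (f x)"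
  shows "restrict f X \<in> carrier (Aut X)"
proof -
  have "homeomorphic_maps (top_of_set X) (top_of_set X) f g"
    using assms by (auto simp: homeomorphic_maps_def)
  then have "homeomorphic_map (top_of_set X) (top_of_set X) f"
    using homeomorphic_map_maps by blast
  then have "homeomorphic_map (top_of_set X) (top_of_set X) (restrict f X)"
    by (rule homeomorphic_map_eq) auto
  moreover have "bij_betw (restrict f X) X X"
    by (rule bij_betw_byWitness[where f' = g]) (use assms in auto)
  ultimately show ?thesis using assms by (auto simp: Aut_def Bij_def)
qed

lemma carrier_Aut_D:
  assumes f: "f \<in> carrier (Aut X)" and inv: "\<And>x. x \<in> X \<Longrightarrow> \<sigma> x \<in> X"
  obtains g where "\<And>x. x \<in> X \<Longrightarrow> f x \<in> X" "\<And>x. x \<in> X \<Longrightarrow> g x \<in> X"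
    "\<And>x. x \<in> X \<Longrightarrow> g (f x) = x" "\<And>x. x \<in> X \<Longrightarrow> f (g x) = x"
    "continuous_on X f" "continuous_on X g"
    "\<And>x. x \<in> X \<Longrightarrow> f (\<sigma> x) = \<sigma> (f x)" "\<And>x. x \<in> X \<Longrightarrow> g (\<sigma> x) = \<sigma> (g x)"
    "f \<in> extensional X"
proof -
  have h: "homeomorphic_map (top_of_set X) (top_of_set X) f" and c: "\<And>x. x \<in> X \<Longrightarrow> f (\<sigma> x) = \<sigma> (f x)"
    and e: "f \<in> extensional X"
    using f by (auto simp: Aut_def Bij_def)
  obtain g where g: "homeomorphic_maps (top_of_set X) (top_of_set X) f g"
    using h by (auto simp: homeomorphic_map_maps)
  have *: "f x \<in> X" "g x \<in> X" "g (f x) = x" "f (g x) = x" if "x \<in> X" for x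
    using g that by (auto simp: homeomorphic_maps_def)
  have "g (\<sigma> x) = \<sigma> (g x)" if "x \<in> X" for x
    by (metis "*"(2,3,4) c inv that)
  then show thesis using * g c e by (intro that[of g]) (auto simp: homeomorphic_maps_def)
qed

lemma commute_shift_int:
  assumes c: "\<And>x. x \<in> X \<Longrightarrow> f (\<sigma> x) = \<sigma> (f x)" and inv: "\<And>n x. x \<in> X \<Longrightarrow> shift n x \<in> X"
    and x: "x \<in> X"
  shows "f (shift n x) = shift n (f x)"
proof -
  have pos: "f (shift (int m) y) = shift (int m) (f y)" if "y \<in> X" for m y
  proof (induction m)
    case (Suc m)
    have "f (\<sigma> (shift (int m) y)) = \<sigma> (shift (int m) (f y))"
      using c[OF inv[OF that]] Suc by simp
    then show ?case by (simp add: add.commute)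
  qed simp
  show ?thesis
  proof (cases "n \<ge> 0")
    case True
    then show ?thesis using pos[OF x, of "nat n"] by simp
  next
    case False
    have "f x = f (shift (int (nat (- n))) (shift n x))" using False by simp
    also have "\<dots> = shift (- n) (f (shift n x))" using pos[OF inv[OF x], of "nat (- n)" n] False by (simp del: shift_shift)
    finally show ?thesis by simp
  qed
qed

lemma shift_in_Aut:
  assumes "\<And>n x. x \<in> X \<Longrightarrow> shift n x \<in> X"
  shows "restrict (shift n) X \<in> carrier (Aut X)"
  by (rule carrier_Aut_I[where g = "shift (- n)"]) (auto simp: assms continuous_on_shift add.commute)

text \<open>
  The Curtis--Hedlund theorem: on a compact shift-invariant set a continuous map that commutes with
  the shift is a sliding block code. A finite subcover of local windows gives a radius for coordinate
  0, and shifting transports it to every coordinate.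
\<close>

lemma uniform_window:
  assumes X: "compact X" and f: "continuous_on X (f :: point \<Rightarrow> point)"
    and c: "\<And>x. x \<in> X \<Longrightarrow> f (\<sigma> x) = \<sigma> (f x)" and inv: "\<And>n x. x \<in> X \<Longrightarrow> shift n x \<in> X"
  obtains r where "r \<ge> 0"
    "\<And>x y k. x \<in> X \<Longrightarrow> y \<in> X \<Longrightarrow> (\<And>i. \<bar>i - k\<bar> \<le> r \<Longrightarrow> x i = y i) \<Longrightarrow> f x k = f y k"
proof -
  have "\<exists>r\<ge>0. \<forall>y\<in>X. (\<forall>i. \<bar>i\<bar> \<le> r \<longrightarrow> y i = x i) \<longrightarrow> f y 0 = f x 0" if "x \<in> X" for x
  proof -
    have "eventually (\<lambda>y. y \<in> X \<longrightarrow> f y 0 = f x 0) (nhds x)"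
      using f that unfolding continuous_on_point_iff eventually_at_filter
      by (auto elim!: eventually_mono)
    from window_neighbourhood[OF this] show ?thesis by blast
  qed
  then obtain R where R: "\<And>x. x \<in> X \<Longrightarrow> R x \<ge> 0"
    "\<And>x y. x \<in> X \<Longrightarrow> y \<in> X \<Longrightarrow> (\<forall>i. \<bar>i\<bar> \<le> R x \<longrightarrow> y i = x i) \<Longrightarrow> f y 0 = f x 0"
    by metis
  define U where "U x = {y :: point. \<forall>i\<in>{- R x..R x}. y i = x i}" for x
  have "open (U x)" for x
  proof -
    have "U x = (\<Inter>i\<in>{- R x..R x}. {y. y i = x i})" by (auto simp: U_def)
    then show ?thesis using open_coordinate_set by (auto intro!: open_INT)
  qed
  moreover have "X \<subseteq> (\<Union>x\<in>X. U x)" by (auto simp: U_def)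
  ultimately obtain C where C: "C \<subseteq> X" "finite C" "X \<subseteq> (\<Union>x\<in>C. U x)"
    using compactE_image[OF X, of X U] by metis
  define r where "r = Max (insert 0 (R ` C))"
  have r: "r \<ge> 0" "\<And>x. x \<in> C \<Longrightarrow> R x \<le> r" using C(2) by (auto simp: r_def)
  have zero: "f x 0 = f y 0" if "x \<in> X" "y \<in> X" "\<And>i. \<bar>i\<bar> \<le> r \<Longrightarrow> x i = y i" for x y
  proof -
    obtain z where z: "z \<in> C" "x \<in> U z" using C(3) \<open>x \<in> X\<close> by blast
    have "\<forall>i. \<bar>i\<bar> \<le> R z \<longrightarrow> x i = z i" using z(2) by (simp add: U_def abs_le_iff minus_le_iff)
    moreover from this have "\<forall>i. \<bar>i\<bar> \<le> R z \<longrightarrow> y i = z i" using that(3) r(2)[OF z(1)] by force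
    ultimately show ?thesis using R(2)[of z x] R(2)[of z y] z(1) C(1) that by auto
  qed
  show thesis
  proof
    fix x y k assume *: "x \<in> X" "y \<in> X" "\<And>i. \<bar>i - k\<bar> \<le> r \<Longrightarrow> x i = y i"
    have "f (shift k x) 0 = f (shift k y) 0"
      by (rule zero) (use * inv in \<open>auto simp: shift_apply\<close>)
    then show "f x k = f y k"
      using commute_shift_int[of X f, OF c inv] * by (simp add: shift_apply)
  qed (fact r(1))
qed

section \<open>Conveyor belts\<close>

text \<open>
  A cell at \<open>p\<close> occupies the positions \<open>p + d * i\<close> with \<open>0 \<le> i < K + 4\<close>. The offsets \<open>0, \<dots>, K - 1\<close> carry
  ones, the offsets \<open>K\<close> and \<open>K + 3\<close> carry zeros, and \<open>K + 1\<close> and \<open>K + 2\<close> are the two data positions. The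
  zeros keep distinct cells in one class modulo \<open>d\<close> from overlapping; \<open>K \<ge> 3\<close> makes a run of ones that
  starts between the two zeros reach the second one.
\<close>

locale conveyor =
  fixes d K :: int
  assumes d_pos: "d > 0" and K_ge: "K \<ge> 3"
begin

definition cell :: "point \<Rightarrow> int \<Rightarrow> bool" where
  "cell x p \<longleftrightarrow> (\<forall>i\<in>{0..<K}. x (p + d * i)) \<and> \<not> x (p + d * K) \<and> \<not> x (p + d * (K + 3))"

text \<open>
  A node \<open>(p, True)\<close> is the upper data bit of the cell at \<open>p\<close>, and \<open>(p, False)\<close> the lower one. The belt
  runs to the right along upper bits and to the left along lower bits, and turns around where the
  neighbouring cell is missing.
\<close>

fun fwd :: "point \<Rightarrow> int \<times> bool \<Rightarrow> int \<times> bool" where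
  "fwd x (p, True) = (if cell x (p + d * (K + 4)) then (p + d * (K + 4), True) else (p, False))"
| "fwd x (p, False) = (if cell x (p - d * (K + 4)) then (p - d * (K + 4), False) else (p, True))"

fun bwd :: "point \<Rightarrow> int \<times> bool \<Rightarrow> int \<times> bool" where
  "bwd x (p, True) = (if cell x (p - d * (K + 4)) then (p - d * (K + 4), True) else (p, False))"
| "bwd x (p, False) = (if cell x (p + d * (K + 4)) then (p + d * (K + 4), False) else (p, True))"

definition walk :: "point \<Rightarrow> int \<Rightarrow> int \<times> bool \<Rightarrow> int \<times> bool" where
  "walk x k s = (if k \<ge> 0 then (fwd x ^^ nat k) s else (bwd x ^^ nat (- k)) s)"

definition slot :: "int \<times> bool \<Rightarrow> int" where
  "slot s = fst s + d * (if snd s then K + 1 else K + 2)"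

definition tape :: "point \<Rightarrow> int \<times> bool \<Rightarrow> point" where
  "tape x s = (\<lambda>k. x (slot (walk x k s)))"

definition belt :: "(point \<Rightarrow> point) \<Rightarrow> point \<Rightarrow> point" where
  "belt \<tau> x = (\<lambda>j.
     if cell x (j - d * (K + 1)) then \<tau> (tape x (j - d * (K + 1), True)) 0
     else if cell x (j - d * (K + 2)) then \<tau> (tape x (j - d * (K + 2), False)) 0
     else x j)"

lemma cell_fwd: "cell x (fst s) \<Longrightarrow> cell x (fst (fwd x s))"
  by (cases "(x, s)" rule: fwd.cases) auto

lemma cell_bwd: "cell x (fst s) \<Longrightarrow> cell x (fst (bwd x s))"
  by (cases "(x, s)" rule: bwd.cases) auto

lemma bwd_fwd: "cell x (fst s) \<Longrightarrow> bwd x (fwd x s) = s"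
  by (cases "(x, s)" rule: fwd.cases) auto

lemma fwd_bwd: "cell x (fst s) \<Longrightarrow> fwd x (bwd x s) = s"
  by (cases "(x, s)" rule: bwd.cases) auto

lemma cell_fwd_funpow: "cell x (fst s) \<Longrightarrow> cell x (fst ((fwd x ^^ n) s))"
  by (induction n) (auto intro: cell_fwd)

lemma cell_bwd_funpow: "cell x (fst s) \<Longrightarrow> cell x (fst ((bwd x ^^ n) s))"
  by (induction n) (auto intro: cell_bwd)

lemma cell_walk: "cell x (fst s) \<Longrightarrow> cell x (fst (walk x k s))"
  by (simp add: walk_def cell_fwd_funpow cell_bwd_funpow)

lemma walk_zero [simp]: "walk x 0 s = s"
  by (simp add: walk_def)

lemma walk_fwd:
  assumes "cell x (fst s)"
  shows "walk x k (fwd x s) = walk x (k + 1) s"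
proof (cases "k \<ge> 0")
  case True
  then have "nat (k + 1) = Suc (nat k)" by simp
  then show ?thesis using True by (simp add: walk_def funpow_swap1)
next
  case False
  then have k: "nat (- k) = Suc (nat (- k - 1))" by simp
  have "walk x k (fwd x s) = (bwd x ^^ nat (- k)) (fwd x s)"
    using False by (simp add: walk_def)
  also have "\<dots> = (bwd x ^^ nat (- k - 1)) s"
    by (simp only: k funpow_Suc_right o_apply bwd_fwd[OF assms])
  also have "\<dots> = walk x (k + 1) s" using False by (cases "k = -1") (auto simp: walk_def)
  finally show ?thesis .
qed

lemma walk_bwd:
  assumes "cell x (fst s)"
  shows "walk x k (bwd x s) = walk x (k - 1) s"
  using walk_fwd[of x "bwd x s" "k - 1"] assms by (simp add: cell_bwd fwd_bwd)

lemma walk_walk: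
  assumes "cell x (fst s)"
  shows "walk x j (walk x k s) = walk x (j + k) s"
proof -
  have "walk x j ((fwd x ^^ n) s) = walk x (j + int n) s" for n j
  proof (induction n arbitrary: j)
    case (Suc n)
    have "walk x j ((fwd x ^^ Suc n) s) = walk x (j + 1) ((fwd x ^^ n) s)"
      using walk_fwd[OF cell_fwd_funpow[OF assms]] by simp
    then show ?case by (simp add: Suc.IH ac_simps)
  qed simp
  moreover have "walk x j ((bwd x ^^ n) s) = walk x (j - int n) s" for n j
  proof (induction n arbitrary: j)
    case (Suc n)
    have "walk x j ((bwd x ^^ Suc n) s) = walk x (j - 1) ((bwd x ^^ n) s)"
      using walk_bwd[OF cell_bwd_funpow[OF assms]] by simp
    then show ?case by (simp add: Suc.IH diff_diff_eq)
  qed simp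
  ultimately show ?thesis by (simp add: walk_def[of x k])
qed

lemma tape_walk: "cell x (fst s) \<Longrightarrow> tape x (walk x k s) = shift k (tape x s)"
  by (simp add: tape_def shift_def walk_walk)

text \<open>
  If the second of two overlapping cells starts at one of the offsets \<open>1, \<dots>, K\<close> of the first, its
  run of ones covers the zero at offset \<open>K\<close>; if it starts later, the run covers the zero at offset
  \<open>K + 3\<close>, because it has length at least three.
\<close>

lemma cells_disjoint:
  assumes "cell x p" "cell x (p + d * m)" "\<bar>m\<bar> < K + 4"
  shows "m = 0"
proof (rule ccontr)
  assume "m \<noteq> 0"
  have no_overlap: False if c: "cell x q" "cell x (q + d * n)" and n: "0 < n" "n < K + 4" for q n
  proof (cases "n \<le> K")
    case True
    then have "x (q + d * n + d * (K - n))" using c(2) n by (auto simp: cell_def)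
    then show False using c(1) by (simp add: cell_def algebra_simps)
  next
    case False
    then have "x (q + d * n + d * (K + 3 - n))" using c(2) n K_ge by (auto simp: cell_def)
    then show False using c(1) by (simp add: cell_def algebra_simps)
  qed
  show False
  proof (cases "m > 0")
    case True
    then show False using no_overlap[of p m] assms by auto
  next
    case False
    then show False using no_overlap[of "p + d * m" "- m"] assms \<open>m \<noteq> 0\<close> by auto
  qed
qed

lemma belt_outside:
  assumes "\<not> cell x (j - d * (K + 1))" "\<not> cell x (j - d * (K + 2))"
  shows "belt \<tau> x j = x j"
  using assms by (simp add: belt_def)

lemma belt_slot:
  assumes "cell x (fst s)"
  shows "belt \<tau> x (slot s) = \<tau> (tape x s) 0"
proof (cases s)
  case (Pair p t)
  have "\<not> cell x (p + d * 1)" using cells_disjoint[of x p 1] assms Pair K_ge by auto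
  moreover have e: "p + d * (K + 2) - d * (K + 1) = p + d" by (simp add: algebra_simps)
  ultimately show ?thesis using assms Pair by (cases t) (simp_all add: belt_def slot_def e)
qed

text \<open>
  In the applications \<open>y\<close> is \<open>x\<close> or its image. An altered marker position would be a data
  position of a cell of \<open>x\<close>, and that cell would overlap the cell of \<open>y\<close> at \<open>p\<close>.
\<close>

lemma belt_marker:
  assumes "\<And>q. cell x q \<Longrightarrow> cell y q" "cell y p" "i \<in> {0..K} \<union> {K + 3}"
  shows "belt \<tau> x (p + d * i) = x (p + d * i)"
proof (rule belt_outside)
  have no: "\<not> cell x (p + d * i - d * c)" if c: "c = K + 1 \<or> c = K + 2" for c
  proof
    assume "cell x (p + d * i - d * c)"
    then have "cell y (p + d * (i - c))" using assms(1) by (simp add: right_diff_distrib add_diff_eq)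
    moreover have "\<bar>i - c\<bar> < K + 4" using assms(3) c K_ge by auto
    ultimately have "i - c = 0" using cells_disjoint assms(2) by blast
    then show False using assms(3) c K_ge by auto
  qed
  show "\<not> cell x (p + d * i - d * (K + 1))" "\<not> cell x (p + d * i - d * (K + 2))"
    by (rule no; simp)+
qed

lemma cell_belt [simp]: "cell (belt \<tau> x) p \<longleftrightarrow> cell x p"
proof -
  have fw: "cell (belt \<tau> x) q" if "cell x q" for q
    using belt_marker[of x x q K \<tau>] belt_marker[of x x q "K + 3" \<tau>] belt_marker[of x x q _ \<tau>] that K_ge
    by (simp add: cell_def)
  show ?thesis
  proof
    assume "cell (belt \<tau> x) p"
    moreover note mark = belt_marker[of x "belt \<tau> x" p _ \<tau>, OF fw this]
    ultimately show "cell x p"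
      using mark[of K] mark[of "K + 3"] mark K_ge by (simp add: cell_def)
  qed (rule fw)
qed

lemma fwd_belt [simp]: "fwd (belt \<tau> x) = fwd x"
proof
  fix s show "fwd (belt \<tau> x) s = fwd x s"
    by (cases "(x, s)" rule: fwd.cases) auto
qed

lemma bwd_belt [simp]: "bwd (belt \<tau> x) = bwd x"
proof
  fix s show "bwd (belt \<tau> x) s = bwd x s"
    by (cases "(x, s)" rule: bwd.cases) auto
qed

lemma walk_belt [simp]: "walk (belt \<tau> x) k s = walk x k s"
  by (simp add: walk_def)

text \<open>
  Every node of the belt is updated by the rule of \<open>\<tau>\<close> at coordinate 0, applied to the tape as seen from
  that node. As \<open>\<tau>\<close> commutes with shifts, the new tape is the \<open>\<tau>\<close>-image of the old one. This is why
  \<open>belt\<close> respects composition.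
\<close>

lemma tape_belt:
  assumes "\<And>k z. \<tau> (shift k z) = shift k (\<tau> z)" "cell x (fst s)"
  shows "tape (belt \<tau> x) s = \<tau> (tape x s)"
proof
  fix k
  have "tape (belt \<tau> x) s k = belt \<tau> x (slot (walk x k s))"
    by (simp add: tape_def)
  also have "\<dots> = \<tau> (tape x (walk x k s)) 0"
    using assms by (intro belt_slot cell_walk)
  also have "\<dots> = \<tau> (tape x s) k" using assms by (simp add: tape_walk shift_apply)
  finally show "tape (belt \<tau> x) s k = \<tau> (tape x s) k" .
qed

lemma belt_compose:
  assumes "\<And>k z. \<tau> (shift k z) = shift k (\<tau> z)"
  shows "belt \<rho> (belt \<tau> x) = belt (\<rho> \<circ> \<tau>) x"
proof
  fix j show "belt \<rho> (belt \<tau> x) j = belt (\<rho> \<circ> \<tau>) x j"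
    unfolding belt_def[of \<rho>] belt_def[of "\<rho> \<circ> \<tau>"]
    using assms by (simp add: tape_belt belt_outside)
qed

lemma belt_id: "belt (\<lambda>z. z) x = x"
  by (simp add: belt_def tape_def slot_def fun_eq_iff)

lemma cell_shift: "cell (shift n x) p \<longleftrightarrow> cell x (p + n)"
  by (simp add: cell_def shift_apply algebra_simps)

definition slide :: "int \<Rightarrow> int \<times> bool \<Rightarrow> int \<times> bool" where
  "slide n s = (fst s + n, snd s)"

lemma fwd_shift: "slide n (fwd (shift n x) s) = fwd x (slide n s)"
  by (cases "(x, s)" rule: fwd.cases) (auto simp: slide_def cell_shift algebra_simps)

lemma bwd_shift: "slide n (bwd (shift n x) s) = bwd x (slide n s)"
  by (cases "(x, s)" rule: bwd.cases) (auto simp: slide_def cell_shift algebra_simps)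

lemma walk_shift:
  "slide n (walk (shift n x) k s) = walk x k (slide n s)"
proof -
  have "slide n ((fwd (shift n x) ^^ m) s) = (fwd x ^^ m) (slide n s)" for m
    by (induction m) (simp_all add: fwd_shift)
  moreover have "slide n ((bwd (shift n x) ^^ m) s) = (bwd x ^^ m) (slide n s)" for m
    by (induction m) (simp_all add: bwd_shift)
  ultimately show ?thesis by (simp add: walk_def)
qed

lemma tape_shift: "tape (shift n x) (p, t) = tape x (p + n, t)"
proof
  fix k
  have "slot (walk x k (p + n, t)) = slot (walk (shift n x) k (p, t)) + n"
    using walk_shift[of n x k "(p, t)", symmetric] by (simp add: slot_def slide_def)
  then show "tape (shift n x) (p, t) k = tape x (p + n, t) k"
    by (simp add: tape_def shift_apply)
qed

lemma belt_shift: "belt \<tau> (shift n x) = shift n (belt \<tau> x)"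
  unfolding belt_def by (simp add: fun_eq_iff cell_shift tape_shift shift_apply algebra_simps)

lemma cell_locally_constant: "eventually (\<lambda>y. cell y p = cell x p) (nhds x)"
proof -
  have "eventually (\<lambda>y. (\<forall>i\<in>{0..<K}. y (p + d * i) = x (p + d * i)) \<and>
      y (p + d * K) = x (p + d * K) \<and> y (p + d * (K + 3)) = x (p + d * (K + 3))) (nhds x)"
    by (intro eventually_conj eventually_ball_finite ballI coordinate_locally_constant) auto
  then show ?thesis by eventually_elim (simp add: cell_def)
qed

lemma fwd_locally_constant: "eventually (\<lambda>y. fwd y s = fwd x s) (nhds x)"
proof (cases "(x, s)" rule: fwd.cases)
  case (1 x' p)
  show ?thesis using cell_locally_constant[of "p + d * (K + 4)" x] 
    by eventually_elim (use 1 in auto)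
next
  case (2 x' p)
  show ?thesis using cell_locally_constant[of "p - d * (K + 4)" x] 
    by eventually_elim (use 2 in auto)
qed

lemma bwd_locally_constant: "eventually (\<lambda>y. bwd y s = bwd x s) (nhds x)"
proof (cases "(x, s)" rule: bwd.cases)
  case (1 x' p)
  show ?thesis using cell_locally_constant[of "p - d * (K + 4)" x] 
    by eventually_elim (use 1 in auto)
next
  case (2 x' p)
  show ?thesis using cell_locally_constant[of "p + d * (K + 4)" x] 
    by eventually_elim (use 2 in auto)
qed

lemma walk_locally_constant: "eventually (\<lambda>y. walk y k s = walk x k s) (nhds x)"
proof -
  have "eventually (\<lambda>y. (fwd y ^^ m) s = (fwd x ^^ m) s) (nhds x)" for m
  proof (induction m)
    case (Suc m)
    then show ?case using fwd_locally_constant[of "(fwd x ^^ m) s" x]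
      by eventually_elim simp
  qed simp
  moreover have "eventually (\<lambda>y. (bwd y ^^ m) s = (bwd x ^^ m) s) (nhds x)" for m
  proof (induction m)
    case (Suc m)
    then show ?case using bwd_locally_constant[of "(bwd x ^^ m) s" x]
      by eventually_elim simp
  qed simp
  ultimately show ?thesis by (simp add: walk_def)
qed

lemma tape_tendsto: "filterlim (\<lambda>y. tape y s) (nhds (tape x s)) (nhds x)"
  unfolding tendsto_point_iff
proof
  fix k show "eventually (\<lambda>y. tape y s k = tape x s k) (nhds x)"
    using walk_locally_constant[of k s x] coordinate_locally_constant[of "slot (walk x k s)" x]
    by eventually_elim (simp add: tape_def)
qed

lemma continuous_on_belt:
  assumes "continuous_on UNIV \<tau>"
  shows "continuous_on X (belt \<tau>)"
proof -
  have tau: "eventually (\<lambda>y. \<tau> (tape y s) 0 = \<tau> (tape x s) 0) (nhds x)" for x s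
  proof -
    have "eventually (\<lambda>w. \<tau> w 0 = \<tau> (tape x s) 0) (at (tape x s))"
      using assms by (auto simp: continuous_on_point_iff)
    then have "eventually (\<lambda>w. \<tau> w 0 = \<tau> (tape x s) 0) (nhds (tape x s))"
      unfolding eventually_at_filter by (rule eventually_mono) auto
    then show ?thesis using tape_tendsto[of s x] by (auto simp: filterlim_iff)
  qed
  have "eventually (\<lambda>y. belt \<tau> y j = belt \<tau> x j) (nhds x)" for x j
    using cell_locally_constant[of "j - d * (K + 1)" x] cell_locally_constant[of "j - d * (K + 2)" x]
      tau[of "(j - d * (K + 1), True)" x] tau[of "(j - d * (K + 2), False)" x]
      coordinate_locally_constant[of j x]
    by eventually_elim (simp add: belt_def)
  then show ?thesis
    unfolding continuous_on_point_iff eventually_at_filter by (auto intro: always_eventually eventually_mono)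
qed

text \<open>
  Every altered position lies in the residue class of some cell of \<open>x\<close>. Add the markers of these
  cells to the unaltered ones of a finite set: a translate that makes all of them free makes
  the whole classes of the cells free.
\<close>

lemma belt_in_hereditary_closure:
  assumes free: "\<And>i. (\<And>k. k \<in> {0..<K} \<Longrightarrow> i + d * k \<in> free_numbers B) \<Longrightarrow> (\<And>k. i + d * k \<in> free_numbers B)"
    and x: "x \<in> hereditary_closure (B_free_subshift B)"
  shows "belt \<tau> x \<in> hereditary_closure (B_free_subshift B)"
  unfolding hereditary_closure_iff
proof (intro allI impI)
  fix A assume A: "finite A" "A \<subseteq> {k. belt \<tau> x k}"
  have "\<exists>q m. cell x q \<and> j = q + d * m" if "\<not> x j" "j \<in> A" for j
  proof -
    have "cell x (j - d * (K + 1)) \<or> cell x (j - d * (K + 2))"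
      using that A(2) belt_outside[of x j \<tau>] by auto
    then show ?thesis by (metis diff_add_cancel)
  qed
  then obtain q m where q: "\<And>j. j \<in> A \<Longrightarrow> \<not> x j \<Longrightarrow> cell x (q j) \<and> j = q j + d * m j" by metis
  let ?A' = "{j\<in>A. x j} \<union> (\<Union>j\<in>{j\<in>A. \<not> x j}. (\<lambda>k. q j + d * k) ` {0..<K})"
  have "finite ?A'" using A(1) by auto
  moreover have "?A' \<subseteq> {k. x k}" using q by (auto simp: cell_def)
  ultimately obtain n where n: "\<And>a. a \<in> ?A' \<Longrightarrow> a + n \<in> free_numbers B"
    using x unfolding hereditary_closure_iff freeable_def by meson
  have "j + n \<in> free_numbers B" if j: "j \<in> A" for j
  proof (cases "x j")
    case False
    have "q j + n + d * m j \<in> free_numbers B"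
    proof (rule free)
      fix k assume "k \<in> {0..<K}"
      then have "q j + d * k + n \<in> free_numbers B" using False j by (intro n UnI2 UN_I[of j]) auto
      then show "q j + n + d * k \<in> free_numbers B" by (simp add: algebra_simps)
    qed
    then show ?thesis using q[OF j False] by (simp add: algebra_simps)
  qed (use n j in auto)
  then show "freeable B A" by (auto simp: freeable_def)
qed

text \<open>
  A chain of cells that is infinite in both directions and displays \<open>z\<close> on its upper bits.
\<close>

lemma belt_separates:
  assumes z: "\<tau> z 0 \<noteq> \<rho> z 0"
  shows "\<exists>x. (\<forall>j. x j \<longrightarrow> d dvd j - a) \<and> belt \<tau> x \<noteq> belt \<rho> x"
proof -
  define x where "x = (\<lambda>j. d dvd j - a \<and> (let i = ((j - a) div d) mod (K + 4); c = ((j - a) div d) div (K + 4) in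
      i < K \<or> i = K + 1 \<and> z c))"
  have x: "x (a + d * (K + 4) * c + d * i) \<longleftrightarrow> i < K \<or> i = K + 1 \<and> z c" if i: "0 \<le> i" "i < K + 4" for c i
  proof -
    have *: "a + d * (K + 4) * c + d * i - a = d * ((K + 4) * c + i)" by (simp add: algebra_simps)
    have "((K + 4) * c + i) mod (K + 4) = i" "((K + 4) * c + i) div (K + 4) = c"
      using i by (simp_all add: mult.commute[of "K + 4"])
    then show ?thesis unfolding x_def * using d_pos by (simp add: Let_def)
  qed
  have cell: "cell x (a + d * (K + 4) * c)" for c
    unfolding cell_def using K_ge by (simp add: x)
  have fwd: "(fwd x ^^ n) (a, True) = (a + d * (K + 4) * int n, True)" for n
  proof (induction n)
    case (Suc n)
    have e: "a + d * (K + 4) * int n + d * (K + 4) = a + d * (K + 4) * int (Suc n)"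
      by (simp add: algebra_simps)
    show ?case using Suc cell[of "int (Suc n)"] by (simp del: of_nat_Suc mult_minus_right add: e)
  qed simp
  have bwd: "(bwd x ^^ n) (a, True) = (a + d * (K + 4) * - int n, True)" for n
  proof (induction n)
    case (Suc n)
    have e: "a + d * (K + 4) * - int n - d * (K + 4) = a + d * (K + 4) * - int (Suc n)"
      by (simp add: algebra_simps)
    show ?case using Suc cell[of "- int (Suc n)"] by (simp del: of_nat_Suc mult_minus_right add: e)
  qed simp
  have walk: "walk x k (a, True) = (a + d * (K + 4) * k, True)" for k
    unfolding walk_def fwd bwd by simp
  have "tape x (a, True) = z"
    unfolding tape_def walk slot_def using K_ge by (simp add: x)
  then have "belt \<tau> x (slot (a, True)) \<noteq> belt \<rho> x (slot (a, True))"
    using belt_slot[of x "(a, True)"] cell[of 0] z by simp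
  moreover have "\<forall>j. x j \<longrightarrow> d dvd j - a" by (auto simp: x_def)
  ultimately show ?thesis by metis
qed

end

section \<open>Embedding the automorphism group of the full shift\<close>

lemma mult_Aut:
  assumes "f \<in> carrier (Aut X)" "g \<in> carrier (Aut X)"
  shows "f \<otimes>\<^bsub>Aut X\<^esub> g = compose X f g"
  using assms by (simp add: Aut_def BijGroup_def)

text \<open>
  If a class modulo \<open>d\<close> contains a multiple of \<open>b\<close>, it contains one among any \<open>b\<close> consecutive terms.
  There are only \<open>d\<close> classes, so finitely many \<open>b\<close> have to be considered.
\<close>

lemma long_run_gives_free_class:
  assumes B: "B \<subseteq> {2..}" and d: "d > (0::int)"
  obtains K where "K \<ge> 3"
    "\<And>i k. (\<And>k. k \<in> {0..<K} \<Longrightarrow> i + d * k \<in> free_numbers B) \<Longrightarrow> i + d * k \<in> free_numbers B"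
proof -
  have "\<exists>b k0. i + d * k \<notin> free_numbers B \<longrightarrow> b \<in> B \<and> int b dvd i + d * k0" for i k
    by (auto simp: free_numbers_def mem_multiples_iff)
  then have "\<exists>b k0. (\<exists>k. i + d * k \<notin> free_numbers B) \<longrightarrow> b \<in> B \<and> int b dvd i + d * k0" for i by metis
  then obtain b k0 where bk: "\<And>i k. i + d * k \<notin> free_numbers B \<Longrightarrow> b i \<in> B \<and> int (b i) dvd i + d * k0 i"
    by metis
  define K where "K = Max (insert 3 ((\<lambda>i. int (b i)) ` {0..<d}))"
  have K: "c \<le> K" if "c \<in> insert 3 ((\<lambda>i. int (b i)) ` {0..<d})" for c
    unfolding K_def using that by (intro Max_ge) auto
  show thesis
  proof (rule that[OF K[of 3]])
    show "3 \<in> insert 3 ((\<lambda>i. int (b i)) ` {0..<d})" by simp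
    fix i k assume run: "\<And>k. k \<in> {0..<K} \<Longrightarrow> i + d * k \<in> free_numbers B"
    show "i + d * k \<in> free_numbers B"
    proof (rule ccontr)
      assume nf: "i + d * k \<notin> free_numbers B"
      define i0 where "i0 = i mod d"
      have i: "i = i0 + d * (i div d)" by (simp add: i0_def)
      have "i0 + d * (i div d + k) = i + d * k" by (subst (2) i) (simp add: algebra_simps)
      then have b: "b i0 \<in> B" "int (b i0) dvd i0 + d * k0 i0"
        using bk[of i0 "i div d + k"] nf by auto
      define j where "j = (k0 i0 - i div d) mod int (b i0)"
      have b0: "int (b i0) > 0" using b(1) B by force
      have "i0 \<in> {0..<d}" using d by (simp add: i0_def)
      then have "int (b i0) \<le> K" by (intro K) auto
      then have "j \<in> {0..<K}"
        using pos_mod_bound[OF b0, of "k0 i0 - i div d"] pos_mod_sign[OF b0, of "k0 i0 - i div d"]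
        by (simp add: j_def)
      then have "i + d * j \<in> free_numbers B" by (rule run)
      moreover have "int (b i0) dvd i + d * j"
      proof -
        have "int (b i0) dvd (k0 i0 - i div d) - j" unfolding j_def by (rule dvd_minus_mod)
        then have "int (b i0) dvd (i0 + d * k0 i0) - d * ((k0 i0 - i div d) - j)"
          by (rule dvd_diff[OF b(2) dvd_mult])
        moreover have "(i0 + d * k0 i0) - d * ((k0 i0 - i div d) - j) = (i0 + d * (i div d)) + d * j"
          by (simp add: algebra_simps)
        ultimately show ?thesis using i by simp
      qed
      ultimately show False using b(1) by (auto simp: free_numbers_def mem_multiples_iff)
    qed
  qed
qed

text \<open>
  For injectivity, the separating points of \<open>belt_separates\<close> are placed on the class of 1 modulo \<open>d\<close>. It
  consists of free numbers, because only trivial common divisors of \<open>b\<close> and \<open>d\<close> divide a number of this class.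
\<close>

theorem Aut_full_shift_embeds:
  assumes B: "B \<subseteq> {2..}" and d: "d > (0::nat)" "\<And>b. b \<in> B \<Longrightarrow> \<not> coprime b d"
  shows "\<exists>h. h \<in> mon (Aut UNIV) (Aut (hereditary_closure (B_free_subshift B)))"
proof -
  let ?Y = "hereditary_closure (B_free_subshift B)"
  obtain K where K: "K \<ge> 3"
    "\<And>i k. (\<And>k. k \<in> {0..<K} \<Longrightarrow> i + int d * k \<in> free_numbers B) \<Longrightarrow> i + int d * k \<in> free_numbers B"
    using long_run_gives_free_class[OF B, of "int d"] d(1) by auto
  interpret conveyor "int d" K by unfold_locales (use d(1) K(1) in auto)
  have sh: "shift n x \<in> ?Y" if "x \<in> ?Y" for n x using that by (rule hereditary_closure_shift)
  have belt_Y: "belt \<tau> x \<in> ?Y" if "x \<in> ?Y" for \<tau> x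
    by (rule belt_in_hereditary_closure[OF _ that]) (use K(2) in blast)
  have inverse: "\<exists>\<tau>'. (\<forall>z. \<tau>' (\<tau> z) = z) \<and> (\<forall>z. \<tau> (\<tau>' z) = z) \<and> continuous_on UNIV \<tau> \<and> continuous_on UNIV \<tau>' \<and>
      (\<forall>k z. \<tau> (shift k z) = shift k (\<tau> z)) \<and> (\<forall>k z. \<tau>' (shift k z) = shift k (\<tau>' z))"
    if \<tau>: "\<tau> \<in> carrier (Aut UNIV)" for \<tau>
  proof -
    obtain \<tau>' where t: "\<And>z. \<tau>' (\<tau> z) = z" "\<And>z. \<tau> (\<tau>' z) = z"
      "continuous_on UNIV \<tau>" "continuous_on UNIV \<tau>'"
      "\<And>z. \<tau> (\<sigma> z) = \<sigma> (\<tau> z)" "\<And>z. \<tau>' (\<sigma> z) = \<sigma> (\<tau>' z)"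
      by (rule carrier_Aut_D[OF \<tau>]) auto
    have "\<tau> (shift k z) = shift k (\<tau> z)" "\<tau>' (shift k z) = shift k (\<tau>' z)" for k z
      using commute_shift_int[of UNIV \<tau> z k] commute_shift_int[of UNIV \<tau>' z k] t(5,6) by auto
    then show ?thesis using t by blast
  qed
  have belt_Aut: "restrict (belt \<tau>) ?Y \<in> carrier (Aut ?Y)" if \<tau>: "\<tau> \<in> carrier (Aut UNIV)" for \<tau>
  proof -
    obtain \<tau>' where t: "\<And>z. \<tau>' (\<tau> z) = z" "\<And>z. \<tau> (\<tau>' z) = z"
      "continuous_on UNIV \<tau>" "continuous_on UNIV \<tau>'"
      "\<And>k z. \<tau> (shift k z) = shift k (\<tau> z)" "\<And>k z. \<tau>' (shift k z) = shift k (\<tau>' z)"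
      using inverse[OF \<tau>] by blast
    show ?thesis
    proof (rule carrier_Aut_I[where g = "belt \<tau>'"])
      show "belt \<tau>' (belt \<tau> x) = x" "belt \<tau> (belt \<tau>' x) = x" for x
        by (simp_all add: belt_compose t o_def belt_id)
      show "continuous_on ?Y (belt \<tau>)" "continuous_on ?Y (belt \<tau>')"
        using t(3,4) by (auto intro: continuous_on_belt)
      show "belt \<tau> (\<sigma> x) = \<sigma> (belt \<tau> x)" for x by (rule belt_shift)
    qed (use belt_Y sh in auto)
  qed
  have "(\<lambda>\<tau>. restrict (belt \<tau>) ?Y) \<in> hom (Aut UNIV) (Aut ?Y)"
  proof (rule homI)
    fix \<tau> \<rho> assume t: "\<tau> \<in> carrier (Aut UNIV)" "\<rho> \<in> carrier (Aut UNIV)"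
    have eq: "compose UNIV \<tau> \<rho> = \<tau> \<circ> \<rho>" by (auto simp: compose_def restrict_def o_def)
    have "belt \<tau> (belt \<rho> x) = belt (\<tau> \<circ> \<rho>) x" for x
      using inverse[OF t(2)] by (intro belt_compose) blast
    then show "restrict (belt (\<tau> \<otimes>\<^bsub>Aut UNIV\<^esub> \<rho>)) ?Y = restrict (belt \<tau>) ?Y \<otimes>\<^bsub>Aut ?Y\<^esub> restrict (belt \<rho>) ?Y"
      using belt_Y by (simp add: mult_Aut[OF t] mult_Aut[OF belt_Aut[OF t(1)] belt_Aut[OF t(2)]] eq)
        (auto simp: compose_def fun_eq_iff)
  qed (rule belt_Aut)
  moreover have "inj_on (\<lambda>\<tau>. restrict (belt \<tau>) ?Y) (carrier (Aut UNIV))"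
  proof (rule inj_onI)
    fix \<tau> \<rho> assume t: "\<tau> \<in> carrier (Aut UNIV)" "\<rho> \<in> carrier (Aut UNIV)"
      and eq: "restrict (belt \<tau>) ?Y = restrict (belt \<rho>) ?Y"
    have zero: "\<tau> z 0 = \<rho> z 0" for z
    proof (rule ccontr)
      assume "\<tau> z 0 \<noteq> \<rho> z 0"
      then obtain x where x: "\<And>j. x j \<Longrightarrow> int d dvd j - 1" "belt \<tau> x \<noteq> belt \<rho> x"
        using belt_separates[of \<tau> z \<rho> 1] by blast
      have "j \<in> free_numbers B" if "x j" for j
      proof -
        have "\<not> int b dvd j" if b: "b \<in> B" for b
        proof
          assume "int b dvd j"
          have "c dvd 1" if c: "c dvd b" "c dvd d" for c
          proof -
            have "int c dvd j" using c(1) \<open>int b dvd j\<close> by (meson dvd_trans int_dvd_int_iff)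
            moreover have "int c dvd j - 1" using c(2) x(1)[OF \<open>x j\<close>] by (meson dvd_trans int_dvd_int_iff)
            ultimately have "int c dvd j - (j - 1)" by (rule dvd_diff)
            then show ?thesis by simp
          qed
          then show False using d(2)[OF b] by (auto intro: coprimeI)
        qed
        then show ?thesis by (simp add: free_numbers_def mem_multiples_iff)
      qed
      then have "x \<in> ?Y"
        by (auto simp: hereditary_closure_iff freeable_def intro!: exI[of _ 0])
      then show False using x(2) eq by (metis restrict_apply')
    qed
    show "\<tau> = \<rho>"
    proof (intro ext)
      fix z k
      have "\<tau> z k = \<tau> (shift k z) 0" "\<rho> z k = \<rho> (shift k z) 0"
        using inverse[OF t(1)] inverse[OF t(2)] by (auto simp: shift_apply)
      then show "\<tau> z k = \<rho> z k" using zero by simp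
    qed
  qed
  ultimately show ?thesis unfolding mon_def by blast
qed


section \<open>The Harris inequality for greatest common divisors\<close>

text \<open>
  The Harris inequality for the uniform weight on \<open>S\<close>: functions that decrease along \<open>R\<close> are
  nonnegatively correlated.
\<close>

definition positively_associated :: "'a set \<Rightarrow> ('a \<Rightarrow> 'a \<Rightarrow> bool) \<Rightarrow> bool" where
  "positively_associated S R \<longleftrightarrow> (\<forall>f h :: 'a \<Rightarrow> real.
     (\<forall>x\<in>S. \<forall>y\<in>S. R x y \<longrightarrow> f y \<le> f x) \<longrightarrow> (\<forall>x\<in>S. \<forall>y\<in>S. R x y \<longrightarrow> h y \<le> h x) \<longrightarrow>
     (\<Sum>x\<in>S. f x) * (\<Sum>x\<in>S. h x) \<le> real (card S) * (\<Sum>x\<in>S. f x * h x))"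

lemma positively_associatedD:
  assumes "positively_associated S R"
    and "\<And>x y. x \<in> S \<Longrightarrow> y \<in> S \<Longrightarrow> R x y \<Longrightarrow> f y \<le> f x"
    and "\<And>x y. x \<in> S \<Longrightarrow> y \<in> S \<Longrightarrow> R x y \<Longrightarrow> h y \<le> h x"
  shows "(\<Sum>x\<in>S. f x) * (\<Sum>x\<in>S. h x) \<le> real (card S) * (\<Sum>x\<in>S. f x * h x)"
  using assms unfolding positively_associated_def by blast

text \<open>
  Chebyshev's sum inequality: two functions that decrease along a total relation are equally ordered,
  so all products of their increments are nonnegative.
\<close>

lemma positively_associated_total:
  assumes "\<And>x y. x \<in> S \<Longrightarrow> y \<in> S \<Longrightarrow> R x y \<or> R y x"
  shows "positively_associated S R"
  unfolding positively_associated_def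
proof (intro allI impI)
  fix f h :: "'a \<Rightarrow> real"
  assume f: "\<forall>x\<in>S. \<forall>y\<in>S. R x y \<longrightarrow> f y \<le> f x" and h: "\<forall>x\<in>S. \<forall>y\<in>S. R x y \<longrightarrow> h y \<le> h x"
  have "0 \<le> (f x - f y) * (h x - h y)" if "x \<in> S" "y \<in> S" for x y
    using assms[OF that] f h that by (auto intro: mult_nonneg_nonneg mult_nonpos_nonpos)
  then have "0 \<le> (\<Sum>x\<in>S. \<Sum>y\<in>S. (f x - f y) * (h x - h y))"
    by (intro sum_nonneg) auto
  also have "\<dots> = (\<Sum>x\<in>S. \<Sum>y\<in>S. f x * h x + f y * h y - (f x * h y + f y * h x))"
    by (intro sum.cong refl) (simp add: algebra_simps)
  also have "\<dots> = 2 * (real (card S) * (\<Sum>x\<in>S. f x * h x)) - 2 * ((\<Sum>x\<in>S. f x) * (\<Sum>x\<in>S. h x))"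
  proof -
    have "(\<Sum>x\<in>S. \<Sum>y\<in>S. f x * h x) = real (card S) * (\<Sum>x\<in>S. f x * h x)"
      "(\<Sum>x\<in>S. \<Sum>y\<in>S. f y * h y) = real (card S) * (\<Sum>x\<in>S. f x * h x)"
      by (simp_all add: sum_distrib_left)
    moreover have "(\<Sum>x\<in>S. \<Sum>y\<in>S. f x * h y) = (\<Sum>x\<in>S. f x) * (\<Sum>x\<in>S. h x)"
      by (simp add: sum_product)
    moreover have "(\<Sum>x\<in>S. \<Sum>y\<in>S. f y * h x) = (\<Sum>x\<in>S. f x) * (\<Sum>x\<in>S. h x)"
      by (subst sum.swap) (simp add: sum_product)
    ultimately show ?thesis by (simp only: sum.distrib sum_subtractf)
  qed
  finally show "(\<Sum>x\<in>S. f x) * (\<Sum>x\<in>S. h x) \<le> real (card S) * (\<Sum>x\<in>S. f x * h x)" by simp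
qed

text \<open>
  The inequality on the fibres, followed by the inequality for the fibre sums.
\<close>

lemma positively_associated_Times:
  assumes S: "positively_associated S R" and T: "positively_associated T Q"
    and reflR: "\<And>x. x \<in> S \<Longrightarrow> R x x" and reflQ: "\<And>x. x \<in> T \<Longrightarrow> Q x x"
  shows "positively_associated (S \<times> T) (\<lambda>(a, b) (c, d). R a c \<and> Q b d)"
  unfolding positively_associated_def
proof (intro allI impI)
  fix f h :: "'a \<times> 'b \<Rightarrow> real"
  let ?R = "\<lambda>(a, b) (c, d). R a c \<and> Q b d"
  assume f: "\<forall>x\<in>S \<times> T. \<forall>y\<in>S \<times> T. ?R x y \<longrightarrow> f y \<le> f x"
    and h: "\<forall>x\<in>S \<times> T. \<forall>y\<in>S \<times> T. ?R x y \<longrightarrow> h y \<le> h x"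
  let ?F = "\<lambda>a. \<Sum>b\<in>T. f (a, b)" and ?H = "\<lambda>a. \<Sum>b\<in>T. h (a, b)"
  have "(\<Sum>x\<in>S \<times> T. f x) * (\<Sum>x\<in>S \<times> T. h x) = (\<Sum>a\<in>S. ?F a) * (\<Sum>a\<in>S. ?H a)"
    by (simp add: sum.cartesian_product)
  also have "\<dots> \<le> real (card S) * (\<Sum>a\<in>S. ?F a * ?H a)"
    using f h reflQ by (intro positively_associatedD[OF S] sum_mono) auto
  also have "\<dots> \<le> real (card S) * (\<Sum>a\<in>S. real (card T) * (\<Sum>b\<in>T. f (a, b) * h (a, b)))"
    using f h reflR by (intro mult_left_mono sum_mono positively_associatedD[OF T]) auto
  also have "\<dots> = real (card (S \<times> T)) * (\<Sum>x\<in>S \<times> T. f x * h x)"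
    by (simp add: sum.cartesian_product sum_distrib_left card_cartesian_product ac_simps)
  finally show "(\<Sum>x\<in>S \<times> T. f x) * (\<Sum>x\<in>S \<times> T. h x) \<le> \<dots>" .
qed

lemma positively_associated_bij:
  assumes S: "positively_associated S R" and g: "bij_betw g S' S"
    and R: "\<And>x y. x \<in> S' \<Longrightarrow> y \<in> S' \<Longrightarrow> R (g x) (g y) \<Longrightarrow> R' x y"
  shows "positively_associated S' R'"
  unfolding positively_associated_def
proof (intro allI impI)
  fix f h :: "'b \<Rightarrow> real"
  assume f: "\<forall>x\<in>S'. \<forall>y\<in>S'. R' x y \<longrightarrow> f y \<le> f x" and h: "\<forall>x\<in>S'. \<forall>y\<in>S'. R' x y \<longrightarrow> h y \<le> h x"
  let ?g = "inv_into S' g"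
  have inv: "?g x \<in> S'" "g (?g x) = x" if "x \<in> S" for x
    using g that by (auto simp: bij_betw_def inv_into_into f_inv_into_f)
  have b: "bij_betw ?g S S'" using g by (rule bij_betw_inv_into)
  have *: "(\<Sum>x\<in>S'. k x) = (\<Sum>x\<in>S. k (?g x))" for k :: "'b \<Rightarrow> real"
    using sum.reindex_bij_betw[OF b, of k] by simp
  show "(\<Sum>x\<in>S'. f x) * (\<Sum>x\<in>S'. h x) \<le> real (card S') * (\<Sum>x\<in>S'. f x * h x)"
    unfolding * bij_betw_same_card[OF g]
    by (rule positively_associatedD[OF S]) (use f h R inv in auto)
qed

lemma bij_betw_mod_Times:
  fixes a b :: nat
  assumes "coprime a b" "a > 0" "b > 0"
  shows "bij_betw (\<lambda>x. (x mod a, x mod b)) {..<a * b} ({..<a} \<times> {..<b})"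
proof -
  have "inj_on (\<lambda>x. (x mod a, x mod b)) {..<a * b}"
  proof (rule inj_onI)
    fix x y assume *: "x \<in> {..<a * b}" "y \<in> {..<a * b}" "(x mod a, x mod b) = (y mod a, y mod b)"
    then have "[x = y] (mod a * b)"
      using assms(1) by (intro coprime_cong_mult_nat) (auto simp: cong_def)
    then show "x = y" using * by (simp add: cong_def)
  qed
  moreover have "(\<lambda>x. (x mod a, x mod b)) ` {..<a * b} \<subseteq> {..<a} \<times> {..<b}" using assms by auto
  ultimately show ?thesis
    unfolding bij_betw_def by (intro conjI card_subset_eq) (auto simp: card_image)
qed

lemma gcd_mod_nat: "gcd (x mod a) a = gcd x (a :: nat)"
  by (metis gcd.commute gcd_red_nat)

text \<open>
  By the Chinese remainder theorem the residues modulo \<open>W\<close> are a product over the prime powers in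
  \<open>W\<close>, and divisibility of gcds is the product order. For a single prime power it is a total
  order.
\<close>

lemma harris_gcd:
  assumes "W > (0::nat)"
  shows "positively_associated {..<W} (\<lambda>x y. gcd x W dvd gcd y W)"
  using assms
proof (induction W rule: less_induct)
  case (less W)
  have primepow: "positively_associated {..<p ^ k} (\<lambda>x y. gcd x (p ^ k) dvd gcd y (p ^ k))" if p: "prime p" for p k :: nat
  proof (rule positively_associated_total)
    fix x y :: nat
    have "gcd x (p ^ k) dvd p ^ k" "gcd y (p ^ k) dvd p ^ k" by auto
    then obtain i j where "gcd x (p ^ k) = p ^ i" "gcd y (p ^ k) = p ^ j"
      unfolding divides_primepow_nat[OF p] by blast
    then show "gcd x (p ^ k) dvd gcd y (p ^ k) \<or> gcd y (p ^ k) dvd gcd x (p ^ k)"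
      using le_imp_power_dvd[of i j p] le_imp_power_dvd[of j i p] by (metis nat_le_linear)
  qed
  show ?case
  proof (cases "W = 1")
    case True
    then show ?thesis by (intro positively_associated_total) auto
  next
    case False
    then obtain p where p: "prime p" "p dvd W" using prime_factor_nat by blast
    define k where "k = multiplicity p W"
    have "\<not> is_unit p" using p(1) by auto
    then obtain m where m: "W = p ^ k * m" "\<not> p dvd m"
      using multiplicity_decompose'[of W p] less.prems unfolding k_def by auto
    have "k > 0" using m p(2) by (cases k) auto
    have m0: "m > 0" "coprime (p ^ k) m" using m less.prems p(1) prime_imp_coprime[of p m] by auto
    have "m < W" using m m0 \<open>k > 0\<close> prime_gt_1_nat[OF p(1)] one_less_power[of p k] by simp
    then have "positively_associated ({..<p ^ k} \<times> {..<m})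
        (\<lambda>(a, b) (c, d). gcd a (p ^ k) dvd gcd c (p ^ k) \<and> gcd b m dvd gcd d m)"
      using less.IH m0 p(1) by (intro positively_associated_Times primepow) auto
    then show ?thesis
    proof (rule positively_associated_bij)
      show "bij_betw (\<lambda>x. (x mod p ^ k, x mod m)) {..<W} ({..<p ^ k} \<times> {..<m})"
        unfolding m(1) using m0 p(1) prime_gt_0_nat[OF p(1)] by (intro bij_betw_mod_Times) auto
    next
      fix x y
      assume "(\<lambda>(a, b) (c, d). gcd a (p ^ k) dvd gcd c (p ^ k) \<and> gcd b m dvd gcd d m)
        (x mod p ^ k, x mod m) (y mod p ^ k, y mod m)"
      then have d: "gcd x (p ^ k) dvd gcd y (p ^ k)" "gcd x m dvd gcd y m"
        by (simp_all only: prod.case gcd_mod_nat)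
      have "gcd x W dvd p ^ k * m" unfolding m(1) by simp
      then obtain e1 e2 where e: "gcd x W = e1 * e2" "e1 dvd p ^ k" "e2 dvd m"
        using division_decomp by blast
      then have "e1 * e2 dvd x" using gcd_dvd1[of x W] by simp
      then have "e1 dvd gcd x (p ^ k)" "e2 dvd gcd x m"
        using e(2,3) dvd_mult_left dvd_mult_right by (auto intro!: gcd_greatest)
      then have "e1 dvd y" "e2 dvd y" using d by (meson dvd_trans gcd_dvd1)+
      moreover have "coprime e1 e2" using e m0(2) by (meson coprime_divisors)
      ultimately have "gcd x W dvd y" unfolding e(1) by (rule divides_mult)
      then show "gcd x W dvd gcd y W" by (simp del: gcd_greatest_iff add: gcd_greatest)
    qed
  qed
qed


section \<open>Sieve densities\<close>

definition avoids :: "nat set \<Rightarrow> nat \<Rightarrow> bool" where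
  "avoids D x \<longleftrightarrow> (\<forall>d\<in>D. \<not> d dvd x)"

text \<open>
  The natural density of the integers without a divisor in the finite set \<open>D\<close>, computed over the
  period \<^term>\<open>\<Prod>D\<close>.
\<close>

definition sieve_density :: "nat set \<Rightarrow> real" where
  "sieve_density D = real (card {x. x < \<Prod>D \<and> avoids D x}) / real (\<Prod>D)"

definition logsum :: "(nat \<Rightarrow> bool) \<Rightarrow> nat \<Rightarrow> real" where
  "logsum P N = (\<Sum>n=1..N. of_bool (P n) / real n)"

lemma periodic_add_mult:
  assumes "\<And>x :: nat. P (x + q) = P x"
  shows "P (x + k * q) = P x"
proof (induction k)
  case (Suc k)
  then show ?case using assms[of "x + k * q"] by (simp add: algebra_simps)
qed simp

lemma periodic_mod:
  assumes "\<And>x :: nat. P (x + q) = P x"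
  shows "P (x mod q) = P x"
  using periodic_add_mult[of P q "x mod q" "x div q"] assms by simp

lemma card_periodic:
  assumes "\<And>x :: nat. P (x + q) = P x"
  shows "card {x. x < k * q \<and> P x} = k * card {x. x < q \<and> P x}"
proof (induction k)
  case (Suc k)
  have "{x. x < Suc k * q \<and> P x} = {x. x < k * q \<and> P x} \<union> (\<lambda>x. x + k * q) ` {x. x < q \<and> P x}"
  proof (intro equalityI subsetI)
    fix x assume x: "x \<in> {x. x < Suc k * q \<and> P x}"
    show "x \<in> {x. x < k * q \<and> P x} \<union> (\<lambda>x. x + k * q) ` {x. x < q \<and> P x}"
    proof (cases "x < k * q")
      case False
      then have "x = (x - k * q) + k * q" "x - k * q < q" using x by auto
      moreover have "P (x - k * q)" using x calculation(1) periodic_add_mult[of P q "x - k * q" k] assms by simp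
      ultimately show ?thesis by blast
    qed (use x in auto)
  qed (use periodic_add_mult[of P q _ k] assms in auto)
  moreover have "card ((\<lambda>x. x + k * q) ` {x. x < q \<and> P x}) = card {x. x < q \<and> P x}"
    by (rule card_image) (auto simp: inj_on_def)
  moreover have "card ({x. x < k * q \<and> P x} \<union> (\<lambda>x. x + k * q) ` {x. x < q \<and> P x})
      = card {x. x < k * q \<and> P x} + card ((\<lambda>x. x + k * q) ` {x. x < q \<and> P x})"
    by (intro card_Un_disjoint) auto
  ultimately show ?case using Suc by simp
qed simp

lemma card_periodic_translate:
  assumes "\<And>x :: nat. P (x + q) = P x" "q > 0"
  shows "card {x. x < q \<and> P (x + a)} = card {x. x < q \<and> P x}"
proof -
  have "inj_on (\<lambda>x. (x + a) mod q) {..<q}"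
  proof (rule inj_onI)
    fix x y assume *: "x \<in> {..<q}" "y \<in> {..<q}" "(x + a) mod q = (y + a) mod q"
    then have "[x + a = y + a] (mod q)" by (simp add: cong_def)
    then have "[x = y] (mod q)" by (simp add: cong_add_rcancel_nat)
    then show "x = y" using * by (simp add: cong_def)
  qed
  moreover have "(\<lambda>x. (x + a) mod q) ` {..<q} = {..<q}"
    by (rule card_subset_eq) (use assms(2) calculation in \<open>auto simp: card_image\<close>)
  ultimately have bij: "bij_betw (\<lambda>x. (x + a) mod q) {..<q} {..<q}" by (simp add: bij_betw_def)
  have "bij_betw (\<lambda>x. (x + a) mod q) {x. x < q \<and> P (x + a)} {x. x < q \<and> P x}"
  proof (rule bij_betw_subset[OF bij])
    show "{x. x < q \<and> P (x + a)} \<subseteq> {..<q}" by auto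
    show "(\<lambda>x. (x + a) mod q) ` {x. x < q \<and> P (x + a)} = {x. x < q \<and> P x}"
    proof (intro equalityI subsetI)
      fix y assume y: "y \<in> {x. x < q \<and> P x}"
      then obtain x where "x < q" "y = (x + a) mod q" using bij by (auto simp: bij_betw_def)
      then show "y \<in> (\<lambda>x. (x + a) mod q) ` {x. x < q \<and> P (x + a)}"
        using y periodic_mod[of P q "x + a"] assms(1) by auto
    qed (use periodic_mod[of P q] assms in auto)
  qed
  then show ?thesis by (rule bij_betw_same_card)
qed

lemma prod_set_pos: "finite D \<Longrightarrow> 0 \<notin> D \<Longrightarrow> \<Prod>D > (0::nat)"
  by (metis gr0I prod_zero_iff)

lemma avoids_add:
  assumes "\<And>d. d \<in> D \<Longrightarrow> d dvd W"
  shows "avoids D (x + W) = avoids D x"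
  using assms by (simp add: avoids_def dvd_add_left_iff)

lemma sieve_density_eq:
  assumes D: "finite D" "0 \<notin> D" and W: "W > 0" "\<And>d. d \<in> D \<Longrightarrow> d dvd W"
  shows "real (card {x. x < W \<and> avoids D x}) = sieve_density D * real W"
proof -
  have per: "avoids D (x + \<Prod>D) = avoids D x" for x
    using D(1) by (intro avoids_add dvd_prodI) auto
  have "W * card {x. x < \<Prod>D \<and> avoids D x} = card {x. x < W * \<Prod>D \<and> avoids D x}"
    using card_periodic[of "avoids D" "\<Prod>D" W] per by simp
  also have "\<dots> = \<Prod>D * card {x. x < W \<and> avoids D x}"
    using card_periodic[of "avoids D" W "\<Prod>D", OF avoids_add[OF W(2)]]
    by (simp only: mult.commute[of W])
  finally have "real W * real (card {x. x < \<Prod>D \<and> avoids D x}) = real (\<Prod>D) * real (card {x. x < W \<and> avoids D x})"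
    unfolding of_nat_mult[symmetric] of_nat_eq_iff .
  moreover have "real (\<Prod>D) > 0" using prod_set_pos[OF D] by (simp only: of_nat_0_less_iff)
  ultimately show ?thesis unfolding sieve_density_def by (simp add: field_simps del: of_nat_prod)
qed

lemma sieve_density_bounds: "finite D \<Longrightarrow> 0 \<notin> D \<Longrightarrow> 0 \<le> sieve_density D \<and> sieve_density D \<le> 1"
proof -
  assume D: "finite D" "0 \<notin> D"
  have "card {x. x < \<Prod>D \<and> avoids D x} \<le> card {..<\<Prod>D}" by (intro card_mono) auto
  then show ?thesis using prod_set_pos[OF D] by (simp add: sieve_density_def del: of_nat_prod)
qed

lemma sieve_density_Un_coprime:
  assumes D: "finite D" "0 \<notin> D" and E: "finite E" "0 \<notin> E" and c: "coprime (\<Prod>D) (\<Prod>E)"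
  shows "sieve_density (D \<union> E) = sieve_density D * sieve_density E"
proof -
  let ?a = "\<Prod>D" and ?b = "\<Prod>E"
  have pos: "?a > 0" "?b > 0" using prod_set_pos D E by auto
  have da: "d dvd ?a" if "d \<in> D" for d using D that by (intro dvd_prodI) auto
  have db: "d dvd ?b" if "d \<in> E" for d using E that by (intro dvd_prodI) auto
  have m: "avoids D (x mod ?a) = avoids D x" "avoids E (x mod ?b) = avoids E x" for x
    using periodic_mod[of "avoids D" ?a] periodic_mod[of "avoids E" ?b] avoids_add da db by auto
  have "bij_betw (\<lambda>x. (x mod ?a, x mod ?b)) {x. x < ?a * ?b \<and> avoids (D \<union> E) x}
      ({x. x < ?a \<and> avoids D x} \<times> {x. x < ?b \<and> avoids E x})"
  proof (rule bij_betw_subset[OF bij_betw_mod_Times[OF c pos]])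
    show "(\<lambda>x. (x mod ?a, x mod ?b)) ` {x. x < ?a * ?b \<and> avoids (D \<union> E) x} =
      {x. x < ?a \<and> avoids D x} \<times> {x. x < ?b \<and> avoids E x}"
    proof (intro equalityI subsetI)
      fix z assume z: "z \<in> {x. x < ?a \<and> avoids D x} \<times> {x. x < ?b \<and> avoids E x}"
      then have "z \<in> (\<lambda>x. (x mod ?a, x mod ?b)) ` {..<?a * ?b}"
        using bij_betw_mod_Times[OF c pos] by (auto simp: bij_betw_def)
      then obtain x where "x < ?a * ?b" "z = (x mod ?a, x mod ?b)" by auto
      then show "z \<in> (\<lambda>x. (x mod ?a, x mod ?b)) ` {x. x < ?a * ?b \<and> avoids (D \<union> E) x}"
        using z m[of x] by (auto simp: avoids_def)
    next
      fix z assume "z \<in> (\<lambda>x. (x mod ?a, x mod ?b)) ` {x. x < ?a * ?b \<and> avoids (D \<union> E) x}"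
      then obtain x where "z = (x mod ?a, x mod ?b)" "avoids D x" "avoids E x"
        by (auto simp: avoids_def)
      then show "z \<in> {x. x < ?a \<and> avoids D x} \<times> {x. x < ?b \<and> avoids E x}"
        using pos m by auto
    qed
  qed auto
  from bij_betw_same_card[OF this] have "real (card {x. x < ?a * ?b \<and> avoids (D \<union> E) x})
      = real (card {x. x < ?a \<and> avoids D x}) * real (card {x. x < ?b \<and> avoids E x})"
    by (simp add: card_cartesian_product)
  moreover have "real (card {x. x < ?a * ?b \<and> avoids (D \<union> E) x}) = sieve_density (D \<union> E) * real (?a * ?b)"
    using D E pos da db by (intro sieve_density_eq) auto
  ultimately show ?thesis using pos unfolding sieve_density_def by (simp add: field_simps del: of_nat_prod)
qed

lemma sieve_density_Un:
  assumes D: "finite D" "0 \<notin> D" and E: "finite E" "0 \<notin> E"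
  shows "1 - sieve_density (D \<union> E) \<le> (1 - sieve_density D) + (1 - sieve_density E)"
proof -
  let ?W = "\<Prod>D * \<Prod>E"
  have W: "?W > 0" using prod_set_pos D E by auto
  have dvd: "d dvd ?W" if "d \<in> D \<union> E" for d
    using that dvd_prodI[OF D(1), of d "\<lambda>x. x"] dvd_prodI[OF E(1), of d "\<lambda>x. x"] by auto
  have "{..<?W} \<subseteq> {x. x < ?W \<and> avoids (D \<union> E) x} \<union> ({..<?W} - {x. x < ?W \<and> avoids D x}) \<union> ({..<?W} - {x. x < ?W \<and> avoids E x})"
    by (auto simp: avoids_def)
  then have "card {..<?W} \<le> card ({x. x < ?W \<and> avoids (D \<union> E) x} \<union> ({..<?W} - {x. x < ?W \<and> avoids D x}) \<union> ({..<?W} - {x. x < ?W \<and> avoids E x}))"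
    by (intro card_mono) auto
  also have "\<dots> \<le> card {x. x < ?W \<and> avoids (D \<union> E) x} + card ({..<?W} - {x. x < ?W \<and> avoids D x}) + card ({..<?W} - {x. x < ?W \<and> avoids E x})"
    by (meson add_le_mono1 card_Un_le le_trans)
  finally have "real ?W \<le> real (card {x. x < ?W \<and> avoids (D \<union> E) x}) + real (card ({..<?W} - {x. x < ?W \<and> avoids D x})) + real (card ({..<?W} - {x. x < ?W \<and> avoids E x}))"
    by (simp only: card_lessThan of_nat_add[symmetric] of_nat_le_iff)
  moreover have "real (card ({..<?W} - {x. x < ?W \<and> avoids C x})) = real ?W - real (card {x. x < ?W \<and> avoids C x})" for C
  proof -
    have "{x. x < ?W \<and> avoids C x} \<subseteq> {..<?W}" by auto
    moreover from this have "finite {x. x < ?W \<and> avoids C x}" by (rule finite_subset) simp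
    ultimately show ?thesis
      using card_mono[of "{..<?W}" "{x. x < ?W \<and> avoids C x}"]
      by (simp add: card_Diff_subset of_nat_diff del: of_nat_prod of_nat_mult)
  qed
  ultimately have "real ?W \<le> sieve_density (D \<union> E) * real ?W + (real ?W - sieve_density D * real ?W) + (real ?W - sieve_density E * real ?W)"
    using sieve_density_eq[of "D \<union> E" ?W] sieve_density_eq[of D ?W] sieve_density_eq[of E ?W] D E W dvd by simp
  then have "(1 - sieve_density (D \<union> E)) * real ?W \<le> ((1 - sieve_density D) + (1 - sieve_density E)) * real ?W"
    by (simp add: algebra_simps)
  then show ?thesis using W by (simp only: mult_le_cancel_right_pos of_nat_0_less_iff)
qed

section \<open>Logarithmic sums over sets of multiples\<close>

lemma logsum_mono:
  assumes "\<And>n. n \<ge> 1 \<Longrightarrow> n \<le> N \<Longrightarrow> P n \<Longrightarrow> Q n"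
  shows "logsum P N \<le> logsum Q N"
  unfolding logsum_def using assms by (intro sum_mono divide_right_mono) auto

lemma logsum_True: "logsum (\<lambda>_. True) N = harm N"
  by (simp add: logsum_def harm_def divide_inverse)

lemma logsum_nonneg: "0 \<le> logsum P N"
  unfolding logsum_def by (intro sum_nonneg) auto

lemma logsum_Int_Diff: "logsum P N = logsum (\<lambda>n. P n \<and> Q n) N + logsum (\<lambda>n. P n \<and> \<not> Q n) N"
  unfolding logsum_def sum.distrib[symmetric] by (intro sum.cong refl) auto

lemma logsum_eq_filter: "logsum P N = (\<Sum>n | n \<in> {1..N} \<and> P n. 1 / real n)"
  unfolding logsum_def by (subst sum.inter_filter) (auto intro!: sum.cong)

lemma card_gcd_eq:
  assumes "W > (0::nat)" "n dvd W"
  shows "card {x. x < W \<and> gcd x W = n} = totient (W div n)"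
proof -
  have "card {x. x < W \<and> gcd x W = n} = card {k\<in>{0<..W}. gcd k W = n}"
  proof (rule bij_betw_same_card)
    show "bij_betw (\<lambda>x. if x = 0 then W else x) {x. x < W \<and> gcd x W = n} {k\<in>{0<..W}. gcd k W = n}"
      by (rule bij_betw_byWitness[where f' = "\<lambda>x. if x = W then 0 else x"]) (use assms in auto)
  qed
  then show ?thesis using card_gcd_eq_totient[OF assms] by simp
qed

text \<open>
  In the residues modulo \<open>W\<close> the events "\<open>x\<close> avoids \<open>D\<close>" and \<open>gcd x W \<le> N\<close> are both
  inherited when \<open>gcd x W\<close> is replaced by a divisor, so they are nonnegatively correlated. If every prime
  factor of \<open>W\<close> still divides \<open>W div n\<close>, the number of \<open>x\<close> with \<open>gcd x W = n\<close> is
  \<open>totient (W div n)\<close>, hence proportional to \<open>1 / n\<close>. The counts modulo \<open>W\<close> thus turn into logarithmic sums.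
\<close>

theorem logsum_avoids_ge:
  assumes D: "finite D" "0 \<notin> D"
  shows "sieve_density D * harm N \<le> logsum (avoids D) N"
proof -
  define V where "V = \<Prod>D * fact N"
  \<comment> \<open>The square ensures that every prime factor of \<open>W\<close> survives in \<open>W div n\<close> for all \<open>n \<le> N\<close>.\<close>
  define W where "W = V * V"
  have V: "V > 0" using prod_set_pos[OF D] by (simp add: V_def)
  then have W: "W > 0" by (simp add: W_def)
  have dV: "d dvd V" if "d \<in> D" for d
    using dvd_prodI[OF D(1) that, of "\<lambda>x. x"] by (simp add: V_def)
  have nV: "n dvd V" if "n \<in> {1..N}" for n
    using that dvd_fact[of n N] by (simp add: V_def)
  define \<kappa> where "\<kappa> = (\<Prod>p\<in>prime_factors W. 1 - 1 / real p)"
  have \<kappa>: "\<kappa> > 0"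
    unfolding \<kappa>_def
  proof (rule prod_pos)
    fix p assume "p \<in> prime_factors W"
    then have "p > 1" using prime_gt_1_nat[OF in_prime_factors_imp_prime] by blast
    then show "0 < 1 - 1 / real p" by simp
  qed
  have cnt: "real (card {x. x < W \<and> gcd x W = n}) = real W * \<kappa> * (1 / real n)" if n: "n \<in> {1..N}" for n
  proof -
    have nW: "n dvd W" using nV[OF n] by (simp add: W_def)
    have "W div n = V * (V div n)" unfolding W_def using nV[OF n] by (simp add: div_mult_swap)
    moreover have "V div n > 0" using nV[OF n] V by (meson div_greater_zero_iff dvd_imp_le dvd_pos_nat)
    moreover have "p dvd V * (V div n) \<longleftrightarrow> p dvd W" if "prime p" for p
      using that dvd_trans[of p "V div n" V] nV[OF n] by (auto simp: W_def prime_dvd_mult_iff div_dvd_iff_mult)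
    ultimately have "prime_factors (W div n) = prime_factors W"
      using V W by (auto simp: prime_factors_dvd)
    then have "real (totient (W div n)) = real (W div n) * \<kappa>"
      by (simp add: totient_formula2 \<kappa>_def)
    then show ?thesis using card_gcd_eq[OF W nW] nW by (simp add: real_of_nat_div)
  qed
  have group: "(\<Sum>x\<in>{..<W}. of_bool (Q (gcd x W)) * of_bool (gcd x W \<le> N)) = real W * \<kappa> * logsum Q N" for Q
  proof -
    let ?S = "{x. x < W \<and> gcd x W \<le> N}"
    have "(\<Sum>x\<in>{..<W}. of_bool (Q (gcd x W)) * of_bool (gcd x W \<le> N)) = (\<Sum>x\<in>?S. of_bool (Q (gcd x W)) :: real)"
      by (rule sum.mono_neutral_cong_right) auto
    also have "\<dots> = (\<Sum>n\<in>{1..N}. \<Sum>x\<in>{x\<in>?S. gcd x W = n}. of_bool (Q (gcd x W)))"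
      using W by (intro sum.group[symmetric]) (auto simp: Suc_le_eq)
    also have "\<dots> = (\<Sum>n\<in>{1..N}. real W * \<kappa> * (of_bool (Q n) / real n))"
    proof (intro sum.cong refl)
      fix n assume n: "n \<in> {1..N}"
      have "(\<Sum>x\<in>{x\<in>?S. gcd x W = n}. of_bool (Q (gcd x W)) :: real) = (\<Sum>x | x < W \<and> gcd x W = n. of_bool (Q n))"
        by (rule sum.cong) (use n in auto)
      also have "\<dots> = real W * \<kappa> * (1 / real n) * of_bool (Q n)"
        by (simp only: sum_constant cnt[OF n])
      finally show "(\<Sum>x\<in>{x\<in>?S. gcd x W = n}. of_bool (Q (gcd x W)) :: real) = real W * \<kappa> * (of_bool (Q n) / real n)"
        by (simp only: times_divide_eq_right mult_1_right times_divide_eq_left)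
    qed
    finally show ?thesis by (simp add: logsum_def sum_distrib_left)
  qed
  have av: "avoids D (gcd x W) = avoids D x" for x
    using dV by (auto simp: avoids_def W_def)
  have "(\<Sum>x\<in>{..<W}. of_bool (avoids D (gcd x W))) * (\<Sum>x\<in>{..<W}. of_bool (gcd x W \<le> N))
     \<le> real (card {..<W}) * (\<Sum>x\<in>{..<W}. of_bool (avoids D (gcd x W)) * of_bool (gcd x W \<le> N))"
  proof (rule positively_associatedD[OF harris_gcd[OF W]])
    fix x y assume d: "gcd x W dvd gcd y W"
    have *: "gcd x W \<le> gcd y W" using d W by (intro dvd_imp_le) auto
    have **: "avoids D (gcd x W)" if "avoids D (gcd y W)"
      using that dvd_trans[OF _ d] unfolding avoids_def by blast
    show "of_bool (avoids D (gcd y W)) \<le> (of_bool (avoids D (gcd x W)) :: real)"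
      "of_bool (gcd y W \<le> N) \<le> (of_bool (gcd x W \<le> N) :: real)"
      using * ** by auto
  qed
  moreover have "(\<Sum>x\<in>{..<W}. of_bool (avoids D (gcd x W))) = sieve_density D * real W"
  proof -
    have "{..<W} \<inter> {x. avoids D x} = {x. x < W \<and> avoids D x}" by auto
    moreover have "d dvd W" if "d \<in> D" for d using dV[OF that] by (simp add: W_def)
    ultimately show ?thesis using sieve_density_eq[OF D W] by (simp add: av)
  qed
  moreover have "(\<Sum>x\<in>{..<W}. of_bool (gcd x W \<le> N)) = real W * \<kappa> * harm N"
    using group[of "\<lambda>_. True"] by (simp add: logsum_True)
  moreover note group[of "avoids D"]
  ultimately have "real W * (real W * \<kappa>) * (sieve_density D * harm N) \<le> real W * (real W * \<kappa>) * logsum (avoids D) N"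
    by (simp add: ac_simps)
  moreover have "real W * (real W * \<kappa>) > 0" using W \<kappa> by simp
  ultimately show ?thesis by (simp only: mult_le_cancel_left_pos)
qed

text \<open>
  Partial summation: the boundary term that is subtracted here makes the increments nonnegative and
  telescoping.
\<close>

lemma logsum_Suc_shift: "\<bar>logsum (\<lambda>n. P (Suc n)) N - logsum P N\<bar> \<le> 2"
proof -
  let ?b = "\<lambda>n. of_bool (P n) :: real"
  let ?E = "\<lambda>N. logsum (\<lambda>n. P (Suc n)) N - logsum P N - ?b (Suc N) / real (Suc N)"
  have "-1 \<le> ?E N \<and> ?E N \<le> 1 - 1 / real (Suc N)"
  proof (induction N)
    case (Suc N)
    have "?E (Suc N) = ?E N + ?b (Suc (Suc N)) * (1 / real (Suc N) - 1 / real (Suc (Suc N)))"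
      by (simp add: logsum_def algebra_simps)
    moreover have "0 \<le> 1 / real (Suc N) - 1 / real (Suc (Suc N))" by (simp add: field_simps)
    ultimately show ?case using Suc by auto
  qed (auto simp: logsum_def)
  moreover have "0 \<le> ?b (Suc N) / real (Suc N)" "?b (Suc N) / real (Suc N) \<le> 1"
    by (auto simp: field_simps)
  moreover have "0 \<le> 1 / real (Suc N)" by simp
  ultimately show ?thesis by linarith
qed

lemma logsum_shift: "\<bar>logsum (\<lambda>n. P (n + a)) N - logsum P N\<bar> \<le> 2 * real a"
proof (induction a)
  case (Suc a)
  have "\<bar>logsum (\<lambda>n. P (Suc n + a)) N - logsum (\<lambda>n. P (n + a)) N\<bar> \<le> 2"
    by (rule logsum_Suc_shift)
  then show ?case using Suc by (simp add: algebra_simps)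
qed simp

text \<open>
  All residue classes are translates of each other, so they have the same logarithmic sum up to a
  bounded error, and together they make up the harmonic number.
\<close>

lemma logsum_residue:
  assumes "r < q"
  shows "\<bar>logsum (\<lambda>n. n mod q = r) N - harm N / real q\<bar> \<le> 4 * real q"
proof -
  let ?u = "\<lambda>r. logsum (\<lambda>n. n mod q = r) N"
  have near: "\<bar>?u s - ?u 0\<bar> \<le> 2 * real q" if "s < q" for s
  proof -
    have "(n + (q - s)) mod q = 0 \<longleftrightarrow> n mod q = s" for n
    proof -
      have "(n + (q - s)) mod q = 0 \<longleftrightarrow> [n + (q - s) = s + (q - s)] (mod q)"
        using that by (simp add: cong_def)
      also have "\<dots> \<longleftrightarrow> [n = s] (mod q)" by (simp add: cong_add_rcancel_nat)
      finally show ?thesis using that by (simp add: cong_def)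
    qed
    then have "\<bar>?u s - ?u 0\<bar> \<le> 2 * real (q - s)"
      using logsum_shift[of "\<lambda>n. n mod q = 0" "q - s" N] by simp
    then show ?thesis by linarith
  qed
  have q: "q > 0" using assms by simp
  have "harm N = (\<Sum>s<q. ?u s)"
  proof -
    have "(\<Sum>s<q. ?u s) = (\<Sum>n=1..N. \<Sum>s<q. of_bool (n mod q = s) / real n)"
      unfolding logsum_def by (rule sum.swap)
    also have "\<dots> = (\<Sum>n=1..N. 1 / real n)"
      using q by (intro sum.cong refl) (simp add: sum_divide_distrib[symmetric] of_bool_def sum.delta')
    finally show ?thesis by (simp add: harm_def divide_inverse)
  qed
  then have "\<bar>harm N - real q * ?u 0\<bar> = \<bar>\<Sum>s<q. ?u s - ?u 0\<bar>"
    by (simp add: sum_subtractf)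
  also have "\<dots> \<le> (\<Sum>s<q. \<bar>?u s - ?u 0\<bar>)" by (rule sum_abs)
  also have "\<dots> \<le> (\<Sum>s<q. 2 * real q)" using near by (intro sum_mono) auto
  finally have "\<bar>harm N - real q * ?u 0\<bar> \<le> 2 * real q * real q" by simp
  then have "\<bar>?u 0 - harm N / real q\<bar> \<le> 2 * real q"
    using q by (simp add: abs_le_iff field_simps)
  then show ?thesis using near[OF assms] by linarith
qed

lemma logsum_periodic:
  assumes "\<And>x. P (x + q) = P x" "q > 0"
  shows "\<bar>logsum P N - real (card {x. x < q \<and> P x}) / real q * harm N\<bar> \<le> 4 * real q * real q"
proof -
  let ?S = "{x. x < q \<and> P x}"
  have "logsum P N = (\<Sum>n=1..N. \<Sum>r\<in>?S. of_bool (n mod q = r) / real n)"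
    unfolding logsum_def
  proof (intro sum.cong refl)
    fix n
    have "n mod q \<in> ?S \<longleftrightarrow> P n" using periodic_mod[of P q n] assms by auto
    then show "of_bool (P n) / real n = (\<Sum>r\<in>?S. of_bool (n mod q = r) / real n)"
      by (simp add: sum_divide_distrib[symmetric] of_bool_def sum.delta')
  qed
  also have "\<dots> = (\<Sum>r\<in>?S. logsum (\<lambda>n. n mod q = r) N)"
    unfolding logsum_def by (rule sum.swap)
  finally have "\<bar>logsum P N - real (card ?S) / real q * harm N\<bar>
      = \<bar>\<Sum>r\<in>?S. logsum (\<lambda>n. n mod q = r) N - harm N / real q\<bar>"
    by (simp add: sum_subtractf)
  also have "\<dots> \<le> (\<Sum>r\<in>?S. \<bar>logsum (\<lambda>n. n mod q = r) N - harm N / real q\<bar>)" by (rule sum_abs)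
  also have "\<dots> \<le> (\<Sum>r\<in>?S. 4 * real q)" by (intro sum_mono logsum_residue) auto
  also have "\<dots> \<le> 4 * real q * real q"
  proof -
    have "card ?S \<le> card {..<q}" by (intro card_mono) auto
    then have "real (card ?S) \<le> real q" by simp
    then show ?thesis by (simp add: mult_right_mono)
  qed
  finally show ?thesis .
qed

section \<open>Consequences of tautness\<close>

lemma free_numbers_iff: "x \<in> free_numbers B \<longleftrightarrow> avoids B (nat \<bar>x\<bar>)"
  by (simp add: free_numbers_def mem_multiples_iff avoids_def int_dvd_int_iff[symmetric])

lemma free_numbers_of_nat [simp]: "int n \<in> free_numbers B \<longleftrightarrow> avoids B n"
  by (simp add: free_numbers_iff)

lemma multiples_of_nat [simp]: "int n \<in> multiples B \<longleftrightarrow> \<not> avoids B n"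
  by (simp add: mem_multiples_iff avoids_def)

lemma log_density_logsum:
  "log_density A = lim (\<lambda>N. 1 / ln (real N) * logsum (\<lambda>n. int n \<in> A) N)"
proof -
  have "(\<Sum>a\<in>{a \<in> A. 1 \<le> a \<and> a \<le> int N}. 1 / real_of_int a) = logsum (\<lambda>n. int n \<in> A) N" for N
  proof -
    have "{a \<in> A. 1 \<le> a \<and> a \<le> int N} = int ` {n. n \<in> {1..N} \<and> int n \<in> A}"
    proof (intro equalityI subsetI)
      fix a assume "a \<in> {a \<in> A. 1 \<le> a \<and> a \<le> int N}"
      then have "a = int (nat a)" "nat a \<in> {n. n \<in> {1..N} \<and> int n \<in> A}" by auto
      then show "a \<in> int ` {n. n \<in> {1..N} \<and> int n \<in> A}" by blast
    qed auto
    then show ?thesis unfolding logsum_eq_filter by (simp add: sum.reindex)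
  qed
  then show ?thesis unfolding log_density_def by simp
qed

text \<open>
  Two sequences whose difference tends to zero have the same limits, and therefore the same value of
  \<^const>\<open>lim\<close>, also when they diverge.
\<close>

lemma log_density_eqI:
  assumes close: "\<And>\<epsilon>. \<epsilon> > 0 \<Longrightarrow> \<exists>C. \<forall>N. \<bar>logsum (\<lambda>n. int n \<in> A) N - logsum (\<lambda>n. int n \<in> A') N\<bar> \<le> \<epsilon> * harm N + C"
  shows "log_density A = log_density A'"
proof -
  let ?f = "\<lambda>N. 1 / ln (real N) * logsum (\<lambda>n. int n \<in> A) N"
  let ?g = "\<lambda>N. 1 / ln (real N) * logsum (\<lambda>n. int n \<in> A') N"
  have lnt: "filterlim (\<lambda>N. ln (real N)) at_top sequentially"
    by (rule filterlim_compose[OF ln_at_top filterlim_real_sequentially])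
  have diff: "(\<lambda>N. ?f N - ?g N) \<longlonglongrightarrow> 0"
  proof (rule LIMSEQ_I)
    fix e :: real assume e: "e > 0"
    then obtain C where C: "\<And>N. \<bar>logsum (\<lambda>n. int n \<in> A) N - logsum (\<lambda>n. int n \<in> A') N\<bar> \<le> e / 2 * harm N + C"
      using close[of "e / 2"] by auto
    have "eventually (\<lambda>N. ln (real N) > 2 / e * (e / 2 + C) \<and> ln (real N) > 0 \<and> N \<ge> 1) sequentially"
      using lnt eventually_ge_at_top by (auto simp: filterlim_at_top_dense intro!: eventually_conj)
    then obtain N0 where N0: "\<And>N. N \<ge> N0 \<Longrightarrow> ln (real N) > 2 / e * (e / 2 + C) \<and> ln (real N) > 0 \<and> N \<ge> 1"
      unfolding eventually_sequentially by blast
    have "norm (?f N - ?g N - 0) < e" if "N \<ge> N0" for N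
    proof -
      have N: "ln (real N) > 2 / e * (e / 2 + C)" "ln (real N) > 0" "N \<ge> 1" using N0[OF that] by auto
      have "harm N \<le> ln (real N) + (1 :: real)"
        using euler_mascheroni_sequence_decreasing[of 1 N] N by (simp add: harm_def)
      then have "e / 2 * harm N + C \<le> e / 2 * (ln (real N) + 1) + C" using e by simp
      moreover have "e / 2 * ln (real N) > e / 2 + C" using N(1) e by (simp add: field_simps)
      ultimately have "\<bar>logsum (\<lambda>n. int n \<in> A) N - logsum (\<lambda>n. int n \<in> A') N\<bar> < e * ln (real N)"
        using C[of N] by (simp add: algebra_simps)
      moreover have "norm (?f N - ?g N - 0) = \<bar>logsum (\<lambda>n. int n \<in> A) N - logsum (\<lambda>n. int n \<in> A') N\<bar> / ln (real N)"
        using N(2) by (simp add: diff_divide_distrib[symmetric] abs_divide)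
      ultimately show ?thesis using N(2) by (simp add: pos_divide_less_eq)
    qed
    then show "\<exists>no. \<forall>N\<ge>no. norm (?f N - ?g N - 0) < e" by blast
  qed
  have "?f \<longlonglongrightarrow> L \<longleftrightarrow> ?g \<longlonglongrightarrow> L" for L
  proof
    assume "?f \<longlonglongrightarrow> L"
    from tendsto_diff[OF this diff] show "?g \<longlonglongrightarrow> L" by simp
  next
    assume "?g \<longlonglongrightarrow> L"
    from tendsto_add[OF this diff] show "?f \<longlonglongrightarrow> L" by simp
  qed
  then show ?thesis unfolding log_density_logsum lim_def by simp
qed

lemma logsum_avoids_le:
  assumes "finite D" "0 \<notin> D"
  obtains C where "\<And>N. logsum (avoids D) N \<le> sieve_density D * harm N + C"
proof -
  have "avoids D (x + \<Prod>D) = avoids D x" for x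
    using assms(1) by (intro avoids_add dvd_prodI) auto
  then have "\<bar>logsum (avoids D) N - sieve_density D * harm N\<bar> \<le> 4 * real (\<Prod>D) * real (\<Prod>D)" for N
    unfolding sieve_density_def using prod_set_pos[OF assms] by (intro logsum_periodic) auto
  then show thesis by (intro that[of "4 * real (\<Prod>D) * real (\<Prod>D)"]) (simp add: abs_le_iff algebra_simps)
qed

lemma taut_primitive:
  assumes "taut B" "b \<in> B" "b' \<in> B" "b' dvd b"
  shows "b' = b"
proof (rule ccontr)
  assume "b' \<noteq> b"
  then have "multiples (B - {b}) = multiples B"
    using assms(2-4) by (auto simp: mem_multiples_iff) (metis DiffI dvd_trans int_dvd_int_iff singletonD)
  then show False using assms(1,2) by (auto simp: taut_def)
qed

text \<open>
  The cofactors \<open>e\<close> of elements \<open>g * e\<close> of \<open>B\<close> that have no prime factor up to \<open>T\<close>. If \<open>b \<in> B\<close> divides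
  \<open>x\<close> and \<open>g\<close> collects the part of \<open>b\<close> that is controlled by a congruence condition on \<open>x\<close>, the
  remaining condition is that \<open>b div g\<close> divides \<open>x\<close>.
\<close>

definition rough_cofactors :: "nat set \<Rightarrow> nat set \<Rightarrow> nat \<Rightarrow> nat set" where
  "rough_cofactors B G T = {e. e \<ge> 2 \<and> coprime e (fact T) \<and> (\<exists>g\<in>G. g * e \<in> B)}"

lemma rough_cofactors_mono: "T \<le> T' \<Longrightarrow> rough_cofactors B G T' \<subseteq> rough_cofactors B G T"
proof -
  assume "T \<le> T'"
  then have "coprime e (fact T)" if "coprime e (fact T')" for e :: nat
    by (rule coprime_divisors[OF dvd_refl fact_dvd that])
  then show ?thesis unfolding rough_cofactors_def by blast
qed

text \<open>
  A zero-one law. If the rough cofactors kept a proportion \<open>\<epsilon>\<close> of multiples for all \<open>T\<close>, one could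
  choose finite blocks of them, each coprime to all the previous ones. Blocks are independent, so the
  numbers that avoid all of them have density zero. This remains true when one cofactor \<open>a\<close> is left
  out, since the blocks can be taken beyond \<open>a\<close>. But a number that is divisible by \<open>g * a\<close> and by no
  other element of \<open>B\<close> is \<open>g\<close> times a number that avoids the blocks; so the removal of
  \<open>g * a\<close> does not change the logarithmic density, against tautness.
\<close>

lemma taut_rough_cofactors_single:
  assumes taut: "taut B" and g: "g > 0" and \<epsilon>: "\<epsilon> > 0"
  shows "\<exists>T. \<forall>D. finite D \<longrightarrow> D \<subseteq> rough_cofactors B {g} T \<longrightarrow> sieve_density D \<ge> 1 - \<epsilon>"
proof (rule ccontr)
  assume "\<not> ?thesis"
  then have sparse: "\<exists>D. finite D \<and> D \<subseteq> rough_cofactors B {g} T \<and> sieve_density D < 1 - \<epsilon>" for T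
    by (meson not_le)
  have not0: "0 \<notin> D" if "D \<subseteq> rough_cofactors B {g} T" for D T using that by (auto simp: rough_cofactors_def)
  have iter: "\<exists>D. finite D \<and> D \<subseteq> rough_cofactors B {g} T \<and> sieve_density D \<le> (1 - \<epsilon>) ^ k" for T k
  proof (induction k)
    case 0
    show ?case by (intro exI[of _ "{}"]) (simp add: sieve_density_def avoids_def)
  next
    case (Suc k)
    then obtain D where D: "finite D" "D \<subseteq> rough_cofactors B {g} T" "sieve_density D \<le> (1 - \<epsilon>) ^ k" by blast
    define T' where "T' = max T (\<Prod>D)"
    obtain D' where D': "finite D'" "D' \<subseteq> rough_cofactors B {g} T'" "sieve_density D' < 1 - \<epsilon>" using sparse by blast
    have Dpos: "\<Prod>D > 0" using prod_set_pos[OF D(1) not0[OF D(2)]] .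
    have "\<Prod>D dvd fact T'" using Dpos by (intro dvd_fact) (auto simp: T'_def)
    then have "coprime (\<Prod>D) d" if "d \<in> D'" for d
      using D'(2) that coprime_divisors[of "\<Prod>D" "fact T'" d d] by (auto simp: rough_cofactors_def coprime_commute)
    then have "coprime (\<Prod>D) (\<Prod>D')" by (intro prod_coprime_right) auto
    then have "sieve_density (D \<union> D') = sieve_density D * sieve_density D'"
      using D D' not0 by (intro sieve_density_Un_coprime) auto
    also have "\<dots> \<le> (1 - \<epsilon>) ^ k * (1 - \<epsilon>)"
      using D D' not0 sieve_density_bounds[of D] sieve_density_bounds[of D'] by (intro mult_mono) auto
    finally have "sieve_density (D \<union> D') \<le> (1 - \<epsilon>) ^ Suc k" by (simp only: power_Suc2)
    moreover have "D \<union> D' \<subseteq> rough_cofactors B {g} T" using D(2) D'(2) rough_cofactors_mono[of T T' B "{g}"] by (auto simp: T'_def)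
    ultimately show ?case using D(1) D'(1) by (intro exI[of _ "D \<union> D'"]) auto
  qed
  obtain D1 where D1: "finite D1" "D1 \<subseteq> rough_cofactors B {g} 0" "sieve_density D1 < 1 - \<epsilon>" using sparse by blast
  have \<epsilon>1: "1 - \<epsilon> > 0" using D1 sieve_density_bounds[of D1] not0 by force
  have "D1 \<noteq> {}" using D1(3) \<epsilon> by (auto simp: sieve_density_def avoids_def)
  then obtain a where a: "a \<ge> 2" "g * a \<in> B" using D1(2) by (auto simp: rough_cofactors_def)
  have "log_density (multiples (B - {g * a})) = log_density (multiples B)"
  proof (rule log_density_eqI)
    fix \<eta> :: real assume "\<eta> > 0"
    then obtain k where k: "(1 - \<epsilon>) ^ k < \<eta>" using real_arch_pow_inv[of \<eta> "1 - \<epsilon>"] \<epsilon> by auto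
    obtain D where D: "finite D" "D \<subseteq> rough_cofactors B {g} a" "sieve_density D \<le> (1 - \<epsilon>) ^ k" using iter by blast
    obtain C where C: "\<And>N. logsum (avoids D) N \<le> sieve_density D * harm N + C"
      using logsum_avoids_le[OF D(1) not0[OF D(2)]] by blast
    have aD: "a \<notin> D"
    proof
      assume "a \<in> D"
      then have "coprime a (fact a)" using D(2) by (auto simp: rough_cofactors_def)
      moreover have "a dvd fact a" using a by (intro dvd_fact) auto
      ultimately show False using a(1) by (metis coprime_absorb_left nat_dvd_1_iff_1 numeral_le_one_iff semiring_norm(69))
    qed
    have "\<bar>logsum (\<lambda>n. int n \<in> multiples (B - {g * a})) N - logsum (\<lambda>n. int n \<in> multiples B) N\<bar> \<le> \<eta> * harm N + C" for N
    proof -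
      let ?P = "\<lambda>n. \<not> avoids B n \<and> avoids (B - {g * a}) n"
      have P: "g dvd n \<and> avoids D (n div g)" if "?P n" for n
      proof -
        have "g * a dvd n" using that by (auto simp: avoids_def)
        then have gn: "g dvd n" by (rule dvd_mult_left)
        moreover have "\<not> d dvd n div g" if "d \<in> D" for d
        proof
          assume "d dvd n div g"
          then have "g * d dvd n" using gn g by (simp add: dvd_div_iff_mult mult.commute)
          moreover have "g * d \<in> B - {g * a}" using \<open>d \<in> D\<close> D(2) aD g by (auto simp: rough_cofactors_def)
          ultimately show False using \<open>?P n\<close> by (auto simp: avoids_def)
        qed
        ultimately show ?thesis by (simp add: avoids_def)
      qed
      let ?S = "{n. n \<in> {1..N} \<and> ?P n}"
      have "logsum ?P N = (\<Sum>n\<in>?S. 1 / real n)" by (rule logsum_eq_filter)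
      also have "\<dots> \<le> (\<Sum>n\<in>?S. 1 / real (n div g))"
      proof (rule sum_mono)
        fix n assume n: "n \<in> ?S"
        then have "g dvd n" using P by blast
        then have "n div g > 0" using n g by (auto elim!: dvdE)
        then show "1 / real n \<le> 1 / real (n div g)"
          by (intro divide_left_mono) (use n in \<open>auto simp: div_le_dividend\<close>)
      qed
      also have "\<dots> = (\<Sum>m\<in>(\<lambda>n. n div g) ` ?S. 1 / real m)"
      proof (rule sum.reindex[symmetric, unfolded o_def])
        show "inj_on (\<lambda>n. n div g) ?S"
        proof (rule inj_onI)
          fix x y assume "x \<in> ?S" "y \<in> ?S" "x div g = y div g"
          then show "x = y" using P by (metis (mono_tags, lifting) dvd_mult_div_cancel mem_Collect_eq)
        qed
      qed
      also have "\<dots> \<le> (\<Sum>m | m \<in> {1..N} \<and> avoids D m. 1 / real m)"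
      proof (rule sum_mono2)
        show "(\<lambda>n. n div g) ` ?S \<subseteq> {m. m \<in> {1..N} \<and> avoids D m}"
        proof (rule image_subsetI)
          fix n assume n: "n \<in> ?S"
          then have *: "g dvd n" "avoids D (n div g)" using P by blast+
          then have "n div g \<ge> 1" using n g by (auto elim!: dvdE)
          moreover have "n div g \<le> N" using n by (intro order.trans[OF div_le_dividend]) auto
          ultimately show "n div g \<in> {m. m \<in> {1..N} \<and> avoids D m}" using * by auto
        qed
      qed auto
      also have "\<dots> = logsum (avoids D) N" by (rule logsum_eq_filter[symmetric])
      also have "\<dots> \<le> sieve_density D * harm N + C" by (rule C)
      also have "\<dots> \<le> \<eta> * harm N + C"
        using D(3) k harm_nonneg[of N, where 'a = real] by (intro add_right_mono mult_right_mono) auto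
      finally have "logsum ?P N \<le> \<eta> * harm N + C" .
      moreover have "logsum (\<lambda>n. \<not> avoids B n) N = logsum (\<lambda>n. \<not> avoids (B - {g * a}) n) N + logsum ?P N"
      proof -
        have "(\<not> avoids B n \<and> \<not> avoids (B - {g * a}) n) = (\<not> avoids (B - {g * a}) n)" for n
          by (auto simp: avoids_def)
        then show ?thesis
          using logsum_Int_Diff[of "\<lambda>n. \<not> avoids B n" N "\<lambda>n. \<not> avoids (B - {g * a}) n"] by simp
      qed
      ultimately show ?thesis using logsum_nonneg[of ?P N] by simp
    qed
    then show "\<exists>C. \<forall>N. \<bar>logsum (\<lambda>n. int n \<in> multiples (B - {g * a})) N - logsum (\<lambda>n. int n \<in> multiples B) N\<bar> \<le> \<eta> * harm N + C"
      by blast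
  qed
  then show False using taut a(2) by (auto simp: taut_def)
qed

lemma taut_rough_cofactors:
  assumes taut: "taut B" and G: "finite G" "0 \<notin> G" and \<epsilon>: "\<epsilon> > 0"
  shows "\<exists>T. \<forall>D. finite D \<longrightarrow> D \<subseteq> rough_cofactors B G T \<longrightarrow> sieve_density D \<ge> 1 - \<epsilon>"
  using G \<epsilon>
proof (induction G arbitrary: \<epsilon> rule: finite_induct)
  case empty
  then have "sieve_density D \<ge> 1 - \<epsilon>" if "D \<subseteq> rough_cofactors B {} T" for D T
    using that by (auto simp: rough_cofactors_def sieve_density_def avoids_def)
  then show ?case by blast
next
  case (insert g G)
  obtain T1 where T1: "\<And>D. finite D \<Longrightarrow> D \<subseteq> rough_cofactors B {g} T1 \<Longrightarrow> sieve_density D \<ge> 1 - \<epsilon> / 2"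
    using taut_rough_cofactors_single[OF taut, of g "\<epsilon> / 2"] insert.prems by auto
  obtain T2 where T2: "\<And>D. finite D \<Longrightarrow> D \<subseteq> rough_cofactors B G T2 \<Longrightarrow> sieve_density D \<ge> 1 - \<epsilon> / 2"
    using insert.IH[of "\<epsilon> / 2"] insert.prems by auto
  have "sieve_density D \<ge> 1 - \<epsilon>" if D: "finite D" "D \<subseteq> rough_cofactors B (insert g G) (max T1 T2)" for D
  proof -
    let ?T = "max T1 T2"
    have "D = (D \<inter> rough_cofactors B {g} ?T) \<union> (D \<inter> rough_cofactors B G ?T)" using D(2) by (auto simp: rough_cofactors_def)
    moreover have "1 - sieve_density ((D \<inter> rough_cofactors B {g} ?T) \<union> (D \<inter> rough_cofactors B G ?T))
        \<le> (1 - sieve_density (D \<inter> rough_cofactors B {g} ?T)) + (1 - sieve_density (D \<inter> rough_cofactors B G ?T))"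
      using D(1) by (intro sieve_density_Un) (auto simp: rough_cofactors_def)
    moreover have "sieve_density (D \<inter> rough_cofactors B {g} ?T) \<ge> 1 - \<epsilon> / 2"
      using D(1) rough_cofactors_mono[of T1 ?T B "{g}"] by (intro T1) auto
    moreover have "sieve_density (D \<inter> rough_cofactors B G ?T) \<ge> 1 - \<epsilon> / 2"
      using D(1) rough_cofactors_mono[of T2 ?T B G] by (intro T2) auto
    ultimately show ?thesis by simp
  qed
  then show ?case by blast
qed

section \<open>Recurrence of free patterns\<close>

lemma logsum_UN:
  assumes "finite A" "\<And>n. P n \<Longrightarrow> R n \<or> (\<exists>a\<in>A. S a n)"
  shows "logsum P N \<le> logsum R N + (\<Sum>a\<in>A. logsum (S a) N)"
proof -
  have "logsum R N + (\<Sum>a\<in>A. logsum (S a) N) = (\<Sum>n=1..N. of_bool (R n) / real n + (\<Sum>a\<in>A. of_bool (S a n) / real n))"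
    unfolding logsum_def sum.distrib by (subst sum.swap) simp
  moreover have "of_bool (P n) / real n \<le> of_bool (R n) / real n + (\<Sum>a\<in>A. of_bool (S a n) / real n)" for n
  proof (cases "P n \<and> \<not> R n")
    case True
    then obtain a where a: "a \<in> A" "S a n" using assms(2) by blast
    have "of_bool (P n) / real n \<le> of_bool (S a n) / real n" using a by simp
    also have "\<dots> \<le> (\<Sum>a\<in>A. of_bool (S a n) / real n)"
      using assms(1) a(1) by (intro member_le_sum) auto
    finally show ?thesis using True by simp
  next
    case False
    have "0 \<le> (\<Sum>a\<in>A. of_bool (S a n) / real n)" by (intro sum_nonneg) auto
    then show ?thesis using False by auto
  qed
  ultimately show ?thesis unfolding logsum_def by (simp add: sum_mono)
qed

text \<open>
  Put \<open>h = gcd x Q\<close> and \<open>g = gcd b h\<close>. As \<open>b div g\<close> is coprime to \<open>h div g\<close>, it divides \<open>x div h\<close>, which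
  is coprime to \<open>Q div h\<close> and hence has no prime factor that is at most \<open>T\<close> or divides \<open>Q\<close>.
\<close>

lemma rough_cofactor_divides:
  assumes b: "b \<in> B" "b dvd x" and h: "gcd x Q \<in> G" "avoids B (gcd x Q)" and x: "x > 0"
    and p: "\<And>p. prime p \<Longrightarrow> p \<le> T \<or> p dvd Q \<Longrightarrow> p dvd Q div gcd x Q" and Q: "Q > 0"
  shows "\<exists>e\<in>rough_cofactors B {g. \<exists>h\<in>G. g dvd h} T. coprime e Q \<and> e dvd x"
proof -
  define h where "h = gcd x Q"
  define g where "g = gcd b h"
  define e where "e = b div g"
  have h0: "h > 0" using x by (simp add: h_def)
  then have g0: "g > 0" by (simp add: g_def)
  have b_eq: "b = g * e" by (simp add: e_def g_def)
  have b0: "b > 0" using b x by (auto intro: Nat.gr0I)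
  have "coprime e (h div g)" unfolding e_def g_def using h0 by (intro div_gcd_coprime) auto
  moreover have "e dvd (h div g) * (x div h)"
  proof -
    have "x = h * (x div h)" by (simp add: h_def)
    moreover have "h = g * (h div g)" by (simp add: g_def)
    ultimately have "g * e dvd g * ((h div g) * (x div h))" using b(2) b_eq by (metis mult.assoc)
    then show ?thesis using g0 by simp
  qed
  ultimately have ex: "e dvd x div h" by (simp add: coprime_dvd_mult_right_iff)
  have no_prime: "\<not> p dvd e" if "prime p" "p \<le> T \<or> p dvd Q" for p
  proof
    assume "p dvd e"
    then have "p dvd x div h" using ex by (rule dvd_trans)
    moreover have "p dvd Q div h" using assms(6)[OF that] by (simp add: h_def)
    moreover have "coprime (x div h) (Q div h)" unfolding h_def using Q by (intro div_gcd_coprime) auto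
    ultimately show False using that(1) by (meson coprime_common_divisor_nat not_prime_1 coprime_common_divisor not_prime_unit)
  qed
  have e_ne: "e \<noteq> 1"
  proof
    assume "e = 1"
    then have "b dvd h" using b_eq by (simp add: g_def) (metis gcd_dvd2)
    then show False using h(2) b(1) by (auto simp: avoids_def h_def)
  qed
  have "coprime e (fact T)"
  proof (rule ccontr)
    assume "\<not> coprime e (fact T)"
    then obtain p where "prime p" "p dvd e" "p dvd fact T"
      using prime_factor_nat[of "gcd e (fact T)"] by (auto simp: coprime_iff_gcd_eq_1)
    then show False using no_prime[of p] prime_dvd_fact_iff[of p T] by auto
  qed
  moreover have "coprime e Q"
  proof (rule ccontr)
    assume "\<not> coprime e Q"
    then obtain p where "prime p" "p dvd e" "p dvd Q"
      using prime_factor_nat[of "gcd e Q"] by (auto simp: coprime_iff_gcd_eq_1)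
    then show False using no_prime[of p] by auto
  qed
  moreover have "e \<ge> 2" using e_ne b0 b_eq by (cases e) auto
  moreover have "g dvd h" by (simp add: g_def)
  moreover have "h \<in> G" using h(1) by (simp add: h_def)
  moreover have "e dvd x"
  proof -
    have "x = (x div h) * h" by (simp add: h_def)
    then show ?thesis using ex by (metis dvd_mult2)
  qed
  ultimately show ?thesis using b(1) b_eq unfolding rough_cofactors_def by blast
qed

lemma card_residue_avoids:
  assumes D: "finite D" "0 \<notin> D" and c: "coprime Q (\<Prod>D)" and Q: "Q > 0"
  shows "real (card {x. x < Q * \<Prod>D \<and> x mod Q = r mod Q \<and> \<not> avoids D (x + a)}) = (1 - sieve_density D) * real (\<Prod>D)"
proof -
  let ?W = "\<Prod>D"
  have W: "?W > 0" using prod_set_pos[OF D] .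
  have per: "avoids D (x + ?W) = avoids D x" for x
    using D(1) by (intro avoids_add dvd_prodI) auto
  have pera: "avoids D (x + ?W + a) = avoids D (x + a)" for x
    using per[of "x + a"] by (simp add: ac_simps)
  have m: "avoids D (x mod ?W + a) = avoids D (x + a)" for x
    using periodic_mod[of "\<lambda>x. avoids D (x + a)" ?W x] pera by blast
  have "bij_betw (\<lambda>x. (x mod Q, x mod ?W)) {x. x < Q * ?W \<and> x mod Q = r mod Q \<and> \<not> avoids D (x + a)}
      ({r mod Q} \<times> {x. x < ?W \<and> \<not> avoids D (x + a)})"
  proof (rule bij_betw_subset[OF bij_betw_mod_Times[OF c Q W]])
    show "(\<lambda>x. (x mod Q, x mod ?W)) ` {x. x < Q * ?W \<and> x mod Q = r mod Q \<and> \<not> avoids D (x + a)} =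
      {r mod Q} \<times> {x. x < ?W \<and> \<not> avoids D (x + a)}"
    proof (intro equalityI subsetI)
      fix z assume z: "z \<in> {r mod Q} \<times> {x. x < ?W \<and> \<not> avoids D (x + a)}"
      then have "z \<in> {..<Q} \<times> {..<?W}" using Q by auto
      then have "z \<in> (\<lambda>x. (x mod Q, x mod ?W)) ` {..<Q * ?W}"
        using bij_betw_mod_Times[OF c Q W] by (simp add: bij_betw_def)
      then obtain x where "x < Q * ?W" "z = (x mod Q, x mod ?W)" by auto
      then show "z \<in> (\<lambda>x. (x mod Q, x mod ?W)) ` {x. x < Q * ?W \<and> x mod Q = r mod Q \<and> \<not> avoids D (x + a)}"
        using z m[of x] by auto
    next
      fix z assume "z \<in> (\<lambda>x. (x mod Q, x mod ?W)) ` {x. x < Q * ?W \<and> x mod Q = r mod Q \<and> \<not> avoids D (x + a)}"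
      then obtain x where "z = (x mod Q, x mod ?W)" "x mod Q = r mod Q" "\<not> avoids D (x + a)" by auto
      then show "z \<in> {r mod Q} \<times> {x. x < ?W \<and> \<not> avoids D (x + a)}" using W m by auto
    qed
  qed auto
  from bij_betw_same_card[OF this]
  have "card {x. x < Q * ?W \<and> x mod Q = r mod Q \<and> \<not> avoids D (x + a)} = card {x. x < ?W \<and> \<not> avoids D (x + a)}"
    by (simp add: card_cartesian_product)
  also have "\<dots> = card {x. x < ?W \<and> \<not> avoids D x}"
    using card_periodic_translate[of "\<lambda>x. \<not> avoids D x" ?W a] per W by simp
  also have "\<dots> = card ({..<?W} - {x. x < ?W \<and> avoids D x})" by (intro arg_cong[of _ _ card]) auto
  also have "\<dots> = ?W - card {x. x < ?W \<and> avoids D x}"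
    by (subst card_Diff_subset) auto
  finally have "real (card {x. x < Q * ?W \<and> x mod Q = r mod Q \<and> \<not> avoids D (x + a)}) = real (?W - card {x. x < ?W \<and> avoids D x})"
    by simp
  moreover have "card {x. x < ?W \<and> avoids D x} \<le> card {..<?W}" by (intro card_mono) auto
  ultimately have "real (card {x. x < Q * ?W \<and> x mod Q = r mod Q \<and> \<not> avoids D (x + a)}) = real ?W - real (card {x. x < ?W \<and> avoids D x})"
    by (simp only: of_nat_diff card_lessThan)
  also have "\<dots> = (1 - sieve_density D) * real ?W" using W by (simp add: sieve_density_def field_simps del: of_nat_prod)
  finally show ?thesis .
qed

lemma sieve_density_near_infimum:
  assumes "\<eta> > 0" "0 \<notin> E"
  obtains D where "finite D" "D \<subseteq> E" "\<And>D'. finite D' \<Longrightarrow> D' \<subseteq> E \<Longrightarrow> sieve_density D' \<ge> sieve_density D - \<eta>"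
proof -
  let ?S = "sieve_density ` {D. finite D \<and> D \<subseteq> E}"
  have ne: "?S \<noteq> {}" by auto
  have bdd: "bdd_below ?S"
    by (rule bdd_belowI[of _ 0]) (use sieve_density_bounds assms(2) in auto)
  have "Inf ?S < Inf ?S + \<eta>" using assms(1) by simp
  then obtain D where D: "finite D" "D \<subseteq> E" "sieve_density D < Inf ?S + \<eta>"
    unfolding cInf_less_iff[OF ne bdd] by blast
  show thesis
  proof (rule that[OF D(1,2)])
    fix D' assume "finite D'" "D' \<subseteq> E"
    then have "sieve_density D' \<in> ?S" by blast
    then have "Inf ?S \<le> sieve_density D'" using bdd by (rule cInf_lower)
    then show "sieve_density D - \<eta> \<le> sieve_density D'" using D(3) by simp
  qed
qed

text \<open>
  In the progression \<open>r\<close> modulo \<open>Q\<close>, the numbers \<open>n + a\<close> have a fixed gcd with \<open>Q\<close>, which is free. By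
  \<open>rough_cofactor_divides\<close> such a number fails to be free only if a rough cofactor coprime to \<open>Q\<close> divides
  it. Split these cofactors into a finite set \<open>D\<close> and the rest. The multiples of \<open>D\<close> are independent of
  the progression and occupy at most the proportion \<open>1 / (4 m)\<close> of it. The numbers that are multiples
  of the rest only have logarithmic density at most \<open>1 / (4 m Q)\<close>, by the choice of \<open>D\<close> and
  \<open>logsum_avoids_ge\<close>. For at most \<open>m\<close> shifts, half of the progression remains.
\<close>

theorem free_pattern_recurrence:
  assumes taut: "taut B" and G: "finite G" "\<And>g. g \<in> G \<Longrightarrow> g > 0 \<and> avoids B g" and m: "m > (0 :: nat)"
  shows "\<exists>T. \<forall>Q r A N. Q > 0 \<longrightarrow> finite A \<longrightarrow> card A \<le> m \<longrightarrow> (\<forall>a\<in>A. gcd (r + a) Q \<in> G) \<longrightarrow>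
      (\<forall>a\<in>A. \<forall>p. prime p \<longrightarrow> p \<le> T \<or> p dvd Q \<longrightarrow> p dvd Q div gcd (r + a) Q) \<longrightarrow>
      (\<exists>n>N. [n = r] (mod Q) \<and> (\<forall>a\<in>A. avoids B (n + a)))"
proof -
  let ?G = "{g. \<exists>h\<in>G. g dvd h}"
  have "?G \<subseteq> {..Max (insert 0 G)}"
  proof
    fix g assume "g \<in> ?G"
    then obtain h where "h \<in> G" "g dvd h" by auto
    then have "g \<le> h" "h \<le> Max (insert 0 G)" using G by (auto intro: dvd_imp_le)
    then show "g \<in> {..Max (insert 0 G)}" by simp
  qed
  then have finG: "finite ?G" by (rule finite_subset) simp
  have "0 \<notin> ?G" using G(2) by auto
  then obtain T where T: "\<And>D. finite D \<Longrightarrow> D \<subseteq> rough_cofactors B ?G T \<Longrightarrow> sieve_density D \<ge> 1 - 1 / (4 * real m)"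
    using taut_rough_cofactors[OF taut finG, of "1 / (4 * real m)"] m by auto
  show ?thesis
  proof (rule exI[of _ T], intro allI impI)
    fix Q r A N
    assume Q: "Q > (0 :: nat)" and A: "finite A" "card A \<le> m" and "\<forall>a\<in>A. gcd (r + a) Q \<in> G"
      and "\<forall>a\<in>A. \<forall>p. prime p \<longrightarrow> p \<le> T \<or> p dvd Q \<longrightarrow> p dvd Q div gcd (r + a) Q"
    then have gcdG: "\<And>a. a \<in> A \<Longrightarrow> gcd (r + a) Q \<in> G"
      and pr: "\<And>a p. a \<in> A \<Longrightarrow> prime p \<Longrightarrow> p \<le> T \<or> p dvd Q \<Longrightarrow> p dvd Q div gcd (r + a) Q" by blast+
    define E where "E = {e \<in> rough_cofactors B ?G T. coprime e Q}"
    have E0: "0 \<notin> E" by (auto simp: E_def rough_cofactors_def)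
    define \<eta> where "\<eta> = 1 / (4 * real m * real Q)"
    have \<eta>: "\<eta> > 0" using m Q by (simp add: \<eta>_def)
    obtain D where D: "finite D" "D \<subseteq> E" "\<And>D'. finite D' \<Longrightarrow> D' \<subseteq> E \<Longrightarrow> sieve_density D' \<ge> sieve_density D - \<eta>"
      using sieve_density_near_infimum[OF \<eta> E0] by blast
    have D0: "0 \<notin> D" using D(2) E0 by auto
    have sD: "1 - sieve_density D \<le> 1 / (4 * real m)" 
    proof -
      have "D \<subseteq> rough_cofactors B ?G T" using D(2) unfolding E_def by blast
      from T[OF D(1) this] show ?thesis by linarith
    qed
    have cQ: "coprime Q (\<Prod>D)" using D(2) by (intro prod_coprime_right) (auto simp: E_def coprime_commute)
    let ?P = "\<lambda>n. n mod Q = r mod Q"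
    let ?bad1 = "\<lambda>a n. ?P n \<and> \<not> avoids D (n + a)"
    let ?bad2 = "\<lambda>a n. avoids D (n + a) \<and> \<not> avoids E (n + a)"
    let ?good = "\<lambda>n. ?P n \<and> (\<forall>a\<in>A. avoids B (n + a))"
    let ?W = "\<Prod>D"
    have W: "?W > 0" using prod_set_pos[OF D(1) D0] .
    have split: "?good n \<or> (\<exists>a\<in>A. ?bad1 a n \<or> ?bad2 a n) \<or> n = 0" if n: "?P n" for n
    proof (rule ccontr)
      assume *: "\<not> ?thesis"
      then obtain a where a: "a \<in> A" "\<not> avoids B (n + a)" using n by auto
      then obtain b where b: "b \<in> B" "b dvd n + a" by (auto simp: avoids_def)
      have "(n + a) mod Q = (r + a) mod Q" using n by (metis mod_add_left_eq)
      then have gg: "gcd (n + a) Q = gcd (r + a) Q" by (metis gcd_mod_nat)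
      have "\<exists>e\<in>rough_cofactors B ?G T. coprime e Q \<and> e dvd n + a"
        using b gg gcdG[OF a(1)] G(2) pr[OF a(1)] Q * by (intro rough_cofactor_divides) auto
      then have "\<not> avoids E (n + a)" by (auto simp: avoids_def E_def)
      then show False using * a(1) n by auto
    qed
    have bad1: "\<exists>C. \<forall>N. logsum (?bad1 a) N \<le> 1 / (4 * real m * real Q) * harm N + C" for a
    proof (intro exI allI)
      fix N
      have per: "?bad1 a (x + Q * ?W) = ?bad1 a x" for x
      proof -
        have "avoids D (x + a + Q * ?W) = avoids D (x + a)"
          using D(1) by (intro avoids_add dvd_mult dvd_prodI) auto
        moreover have "x + Q * ?W + a = x + a + Q * ?W" by simp
        ultimately show ?thesis by (simp only: mod_mult_self2)
      qed
      have dev: "\<bar>logsum (?bad1 a) N - real (card {x. x < Q * ?W \<and> ?bad1 a x}) / real (Q * ?W) * harm N\<bar>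
          \<le> 4 * real (Q * ?W) * real (Q * ?W)"
        using per Q W by (intro logsum_periodic) auto
      have "real (card {x. x < Q * ?W \<and> ?bad1 a x}) / real (Q * ?W) = (1 - sieve_density D) / real Q"
        unfolding card_residue_avoids[OF D(1) D0 cQ Q] using W Q by (simp del: of_nat_prod)
      moreover have "(1 - sieve_density D) / real Q * harm N \<le> 1 / (4 * real m * real Q) * harm N"
      proof -
        have "(1 - sieve_density D) / real Q \<le> 1 / (4 * real m) / real Q" using sD by (intro divide_right_mono) auto
        then show ?thesis using harm_nonneg[of N, where 'a = real] by (intro mult_right_mono) (auto simp: field_simps)
      qed
      ultimately have "real (card {x. x < Q * ?W \<and> ?bad1 a x}) / real (Q * ?W) * harm N
          \<le> 1 / (4 * real m * real Q) * harm N" by (simp only:)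
      moreover have "u \<le> w + c" if "\<bar>u - v\<bar> \<le> c" "v \<le> w" for u v w c :: real using that by linarith
      ultimately show "logsum (?bad1 a) N \<le> 1 / (4 * real m * real Q) * harm N + 4 * real (Q * ?W) * real (Q * ?W)"
        using dev by blast
    qed
    have bad2: "\<exists>C. \<forall>N. logsum (?bad2 a) N \<le> 1 / (4 * real m * real Q) * harm N + C" for a
    proof -
      obtain C where C: "\<And>N. logsum (avoids D) N \<le> sieve_density D * harm N + C"
        using logsum_avoids_le[OF D(1) D0] by blast
      have "logsum (?bad2 a) N \<le> \<eta> * harm N + (C + 2 * real a)" for N
      proof -
        have "logsum (?bad2 a) N \<le> logsum (\<lambda>n. avoids D n \<and> \<not> avoids E n) N + 2 * real a"
          using logsum_shift[of "\<lambda>n. avoids D n \<and> \<not> avoids E n" a N] by (simp add: abs_le_iff)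
        also have "logsum (\<lambda>n. avoids D n \<and> \<not> avoids E n) N = logsum (avoids D) N - logsum (avoids E) N"
        proof -
          have "(avoids D n \<and> avoids E n) = avoids E n" for n using D(2) by (auto simp: avoids_def)
          then show ?thesis using logsum_Int_Diff[of "avoids D" N "avoids E"] by simp
        qed
        finally have "logsum (?bad2 a) N \<le> logsum (avoids D) N - logsum (avoids E) N + 2 * real a" .
        moreover have "logsum (avoids E) N \<ge> (sieve_density D - \<eta>) * harm N"
        proof -
          have "(sieve_density D - \<eta>) * harm N \<le> sieve_density (E \<inter> {..N}) * harm N"
            using D(3)[of "E \<inter> {..N}"] harm_nonneg[of N, where 'a = real] by (intro mult_right_mono) auto
          also have "\<dots> \<le> logsum (avoids (E \<inter> {..N})) N" using E0 by (intro logsum_avoids_ge) auto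
          also have "\<dots> \<le> logsum (avoids E) N"
          proof (rule logsum_mono)
            fix n assume n: "1 \<le> n" "n \<le> N" "avoids (E \<inter> {..N}) n"
            show "avoids E n"
              unfolding avoids_def
            proof (intro ballI notI)
              fix e assume e: "e \<in> E" "e dvd n"
              then have "e \<le> N" using n by (meson dvd_imp_le le_trans less_le_trans zero_less_one)
              then show False using e n(3) by (auto simp: avoids_def)
            qed
          qed
          finally show ?thesis .
        qed
        ultimately show ?thesis using C[of N] by (simp add: algebra_simps)
      qed
      then show ?thesis unfolding \<eta>_def by blast
    qed
    obtain C1 where C1: "\<And>a N. logsum (?bad1 a) N \<le> 1 / (4 * real m * real Q) * harm N + C1 a" using bad1 by metis
    obtain C2 where C2: "\<And>a N. logsum (?bad2 a) N \<le> 1 / (4 * real m * real Q) * harm N + C2 a" using bad2 by metis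
    define C where "C = (\<Sum>a\<in>A. C1 a + C2 a) + 4 * real Q"
    have lower: "harm M / (2 * real Q) - C \<le> logsum ?good M" for M
    proof -
      have "logsum ?P M \<le> logsum (\<lambda>n. ?good n \<or> n = 0) M + (\<Sum>a\<in>A. logsum (\<lambda>n. ?bad1 a n \<or> ?bad2 a n) M)"
        using split by (intro logsum_UN A) blast
      also have "logsum (\<lambda>n. ?good n \<or> n = 0) M \<le> logsum ?good M" by (rule logsum_mono) auto
      also have "(\<Sum>a\<in>A. logsum (\<lambda>n. ?bad1 a n \<or> ?bad2 a n) M) \<le> (\<Sum>a\<in>A. logsum (?bad1 a) M + logsum (?bad2 a) M)"
      proof (rule sum_mono)
        fix a
        show "logsum (\<lambda>n. ?bad1 a n \<or> ?bad2 a n) M \<le> logsum (?bad1 a) M + logsum (?bad2 a) M"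
          using logsum_UN[of "{()}" "\<lambda>n. ?bad1 a n \<or> ?bad2 a n" "?bad1 a" "\<lambda>_. ?bad2 a" M] by simp
      qed
      also have "\<dots> \<le> (\<Sum>a\<in>A. 1 / (2 * real m * real Q) * harm M + (C1 a + C2 a))"
      proof (rule sum_mono)
        fix a
        have "1 / (4 * real m * real Q) * harm M + 1 / (4 * real m * real Q) * harm M = 1 / (2 * real m * real Q) * harm M"
          by (simp add: field_simps)
        then show "logsum (?bad1 a) M + logsum (?bad2 a) M \<le> 1 / (2 * real m * real Q) * harm M + (C1 a + C2 a)"
          using C1[of a M] C2[of a M] by linarith
      qed
      also have "\<dots> = real (card A) * (1 / (2 * real m * real Q) * harm M) + (\<Sum>a\<in>A. C1 a + C2 a)"
        by (simp add: sum.distrib)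
      also have "real (card A) * (1 / (2 * real m * real Q) * harm M) \<le> real m * (1 / (2 * real m * real Q) * harm M)"
        using A(2) harm_nonneg[of M, where 'a = real] by (intro mult_right_mono) auto
      also have "\<dots> = harm M / (2 * real Q)" using m by (simp add: field_simps)
      finally have "logsum ?P M \<le> logsum ?good M + (harm M / (2 * real Q) + (\<Sum>a\<in>A. C1 a + C2 a))" by simp
      moreover have "harm M / real Q - 4 * real Q \<le> logsum ?P M"
        using logsum_residue[of "r mod Q" Q M] Q by (simp add: abs_le_iff)
      moreover have "harm M / real Q = harm M / (2 * real Q) + harm M / (2 * real Q)" by (simp add: field_simps)
      ultimately show ?thesis unfolding C_def by linarith
    qed
    show "\<exists>n>N. [n = r] (mod Q) \<and> (\<forall>a\<in>A. avoids B (n + a))"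
    proof (rule ccontr)
      assume none: "\<not> ?thesis"
      have up: "logsum ?good M \<le> harm N" for M
      proof -
        have "logsum ?good M = (\<Sum>n | n \<in> {1..M} \<and> ?good n. 1 / real n)" by (rule logsum_eq_filter)
        also have "\<dots> \<le> (\<Sum>n\<in>{1..N}. 1 / real n)"
          by (rule sum_mono2) (use none in \<open>auto simp: cong_def not_less\<close>)
        finally show ?thesis by (simp add: harm_def divide_inverse)
      qed
      have "filterlim (harm :: nat \<Rightarrow> real) at_top sequentially" by (rule harm_at_top)
      then obtain M where "harm M > 2 * real Q * (harm N + C)"
        unfolding filterlim_at_top_dense eventually_sequentially by blast
      then have "harm M / (2 * real Q) > harm N + C" using Q by (simp add: field_simps)
      then show False using lower[of M] up[of M] by linarith
    qed
  qed
qed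

text \<open>
  With \<open>g = gcd c b\<close>, which is free since \<open>B\<close> is primitive, write the class as \<open>g\<close> times a class that is
  prime to \<open>b div g\<close>. The representative \<open>g * k\<close> is chosen with \<open>k\<close> coprime to \<open>b\<close> and to all primes up
  to the bound \<open>T\<close> of \<open>free_pattern_recurrence\<close>.
\<close>

lemma free_numbers_residue_class:
  assumes taut: "taut B" and B: "B \<subseteq> {2..}" and b: "b \<in> B" and c: "\<not> b dvd c"
  shows "\<exists>n>N. [n = c] (mod b) \<and> avoids B n"
proof -
  define g where "g = gcd c b"
  have b2: "b \<ge> 2" using B b by auto
  have g: "g > 0" "g dvd b" "g dvd c" using b2 by (auto simp: g_def)
  have "g \<noteq> b" using c by (metis gcd_dvd1 g_def)
  have avg: "avoids B g"
    unfolding avoids_def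
  proof (intro ballI notI)
    fix b' assume b': "b' \<in> B" "b' dvd g"
    then have "b' = b" using taut_primitive[OF taut b] g(2) by (meson dvd_trans)
    then show False using b' g \<open>g \<noteq> b\<close> by (auto intro: dvd_antisym)
  qed
  have gG: "g' > 0 \<and> avoids B g'" if "g' \<in> {g}" for g' using that avg g(1) by simp
  obtain T where T: "\<And>Q r A N. Q > 0 \<Longrightarrow> finite A \<Longrightarrow> card A \<le> 1 \<Longrightarrow> (\<forall>a\<in>A. gcd (r + a) Q \<in> {g}) \<Longrightarrow>
      (\<forall>a\<in>A. \<forall>p. prime p \<longrightarrow> p \<le> T \<or> p dvd Q \<longrightarrow> p dvd Q div gcd (r + a) Q) \<Longrightarrow>
      (\<exists>n>N. [n = r] (mod Q) \<and> (\<forall>a\<in>A. avoids B (n + a)))"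
    using free_pattern_recurrence[OF taut finite.insertI[OF finite.emptyI] gG zero_less_one] by blast
  define M where "M = b * fact T"
  have M: "M > 0" using b2 by (simp add: M_def)
  define c' where "c' = c div g"
  define q where "q = b div g"
  have cq: "c = g * c'" "b = g * q" using g by (simp_all add: c'_def q_def)
  have cop: "coprime c' q" unfolding c'_def q_def g_def using b2 by (intro div_gcd_coprime) auto
  \<comment> \<open>A prime factor of \<open>M\<close> divides exactly one of \<open>c'\<close> and \<open>q * s\<close>, so it does not divide their sum.\<close>
  define s where "s = \<Prod>{p \<in> prime_factors M. \<not> p dvd c'}"
  define k where "k = c' + q * s"
  have kM: "coprime k M"
  proof (rule ccontr)
    assume "\<not> coprime k M"
    then obtain p where p: "prime p" "p dvd k" "p dvd M"
      using prime_factor_nat[of "gcd k M"] by (auto simp: coprime_iff_gcd_eq_1)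
    show False
    proof (cases "p dvd c'")
      case True
      then have "p dvd q * s" using p(2) unfolding k_def by (simp add: dvd_add_right_iff)
      then consider "p dvd q" | "p dvd s" using p(1) by (auto simp: prime_dvd_mult_iff)
      then show False
      proof cases
        case 1
        then show False using cop True p(1) by (meson coprime_common_divisor not_prime_unit)
      next
        case 2
        then obtain p' where p': "p' \<in> prime_factors M" "\<not> p' dvd c'" "p dvd p'"
          unfolding s_def using prime_dvd_prod_iff[of "{p \<in> prime_factors M. \<not> p dvd c'}" p "\<lambda>x. x"] p(1) by auto
        then have "p = p'" using p(1) primes_dvd_imp_eq in_prime_factors_imp_prime by blast
        then show False using True p' by simp
      qed
    next
      case False
      then have "p dvd s" unfolding s_def using p M
        by (intro dvd_prodI[of _ _ "\<lambda>x. x", simplified]) (auto simp: prime_factors_dvd)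
      then have "p dvd c'" using p(2) unfolding k_def by (metis dvd_add_left_iff dvd_mult)
      then show False using False by simp
    qed
  qed
  have gcdk: "gcd (g * k) (g * M) = g" using kM by (simp add: gcd_mult_distrib_nat[symmetric] coprime_iff_gcd_eq_1)
  have "\<exists>n>N. [n = g * k] (mod g * M) \<and> (\<forall>a\<in>{0}. avoids B (n + a))"
  proof (rule T; (intro ballI allI impI)?)
    fix a p :: nat assume "a \<in> {0}" and p: "prime p" "p \<le> T \<or> p dvd g * M"
    have "p dvd M"
    proof (cases "p \<le> T")
      case True
      then show ?thesis using p(1) prime_dvd_fact_iff[of p T] by (simp add: M_def)
    next
      case False
      then have "p dvd g \<or> p dvd M" using p prime_dvd_mult_iff by blast
      then show ?thesis using g(2) by (auto simp: M_def intro: dvd_trans)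
    qed
    then show "p dvd g * M div gcd (g * k + a) (g * M)" using \<open>a \<in> {0}\<close> gcdk g(1) by simp
  qed (use gcdk g(1) M in auto)
  then obtain n where n: "n > N" "[n = g * k] (mod g * M)" "avoids B n" by auto
  have "b dvd g * M" by (simp add: M_def)
  then have "[n = g * k] (mod b)" using n(2) cong_dvd_modulus_nat by blast
  moreover have "g * k = c + b * s" by (simp add: k_def cq algebra_simps)
  ultimately have "[n = c] (mod b)" by (simp add: cong_def)
  then show ?thesis using n by blast
qed

lemma cong_nat_mod:
  assumes "[r = nat (x mod int q)] (mod q)" "q > 0"
  shows "[int r = x] (mod int q)"
proof -
  have "[int r = int (nat (x mod int q))] (mod int q)" using assms(1) by (simp only: cong_int_iff)
  moreover have "int (nat (x mod int q)) = x mod int q" using assms(2) by simp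
  ultimately show ?thesis by (simp only: cong_def mod_mod_trivial)
qed

text \<open>
  A translation by a multiple of \<open>V * V\<close>, where \<open>V\<close> is a multiple of all \<open>a \<in> A\<close>, leaves their gcds with
  \<open>V * V\<close> unchanged. For \<open>b \<in> B\<close> coprime to \<open>V\<close> and to all \<open>a - \<alpha>\<close>, it may also be prescribed to be
  \<open>- \<alpha>\<close> modulo \<open>b\<close>, and then \<open>b\<close> is coprime to the translates of \<open>A\<close> because these are
  congruent to the \<open>a - \<alpha>\<close>.
\<close>

lemma simultaneously_free:
  assumes taut: "taut B" and B: "B \<subseteq> {2..}" and cop: "\<And>d. d > 0 \<Longrightarrow> \<exists>b\<in>B. coprime b d"
    and A: "finite A" "A \<subseteq> free_numbers B" and \<alpha>: "\<alpha> \<notin> A"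
  obtains n b where "b \<in> B" "\<And>a. a \<in> A \<Longrightarrow> a + n \<in> free_numbers B" "int b dvd \<alpha> + n"
proof -
  define G where "G = (\<lambda>a. nat \<bar>a\<bar>) ` A"
  have "B \<noteq> {}" using cop[of 1] by auto
  then have A0: "0 \<notin> A" using A(2) by (auto simp: free_numbers_iff avoids_def)
  have G: "finite G" "\<And>g. g \<in> G \<Longrightarrow> g > 0 \<and> avoids B g"
    using A A0 by (auto simp: G_def free_numbers_iff subset_iff)
  obtain T where T: "\<And>Q r A' N. Q > 0 \<Longrightarrow> finite A' \<Longrightarrow> card A' \<le> Suc (card A) \<Longrightarrow> (\<forall>a\<in>A'. gcd (r + a) Q \<in> G) \<Longrightarrow>
      (\<forall>a\<in>A'. \<forall>p. prime p \<longrightarrow> p \<le> T \<or> p dvd Q \<longrightarrow> p dvd Q div gcd (r + a) Q) \<Longrightarrow>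
      (\<exists>n>N. [n = r] (mod Q) \<and> (\<forall>a\<in>A'. avoids B (n + a)))"
    using free_pattern_recurrence[OF taut G, of "Suc (card A)"] by blast
  define V where "V = fact T * \<Prod>G"
  have V: "V > 0" using G prod_set_pos[of G] by (auto simp: V_def)
  define U where "U = (\<Prod>a\<in>A. nat \<bar>a - \<alpha>\<bar>)"
  have U: "U > 0" unfolding U_def using A(1) \<alpha> by (intro prod_pos) auto
  obtain b where b: "b \<in> B" "coprime b (V * U)" using cop[of "V * U"] V U by auto
  have bV: "coprime b V" and bU: "coprime b U" using b(2) by auto
  have b0: "b > 0" using B b(1) by force
  \<comment> \<open>The recurrence theorem speaks of natural numbers; adding \<open>m\<close> makes all elements of \<open>A\<close> nonnegative.\<close>
  define m where "m = (\<Sum>a\<in>A. nat \<bar>a\<bar>)"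
  have am: "0 \<le> a + int m" if "a \<in> A" for a
  proof -
    have "nat \<bar>a\<bar> \<le> m" unfolding m_def using A(1) that by (intro member_le_sum) auto
    then show ?thesis by linarith
  qed
  define Q where "Q = V * V * b"
  have Q: "Q > 0" using V b0 by (simp add: Q_def)
  obtain r where r: "[r = nat ((- int m) mod int (V * V))] (mod V * V)" "[r = nat ((- \<alpha> - int m) mod int b)] (mod b)"
    using binary_chinese_remainder_nat[of "V * V" b] bV by (auto simp: coprime_commute)
  have r1: "[int r + int m = 0] (mod int (V * V))"
  proof -
    have "[int r = - int m] (mod int (V * V))"
      by (rule cong_nat_mod[OF r(1)]) (use V in simp)
    from cong_add[OF this cong_refl[of "int m"]] show ?thesis by simp
  qed
  have r2: "[int r + int m = - \<alpha>] (mod int b)"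
  proof -
    have "[int r = - \<alpha> - int m] (mod int b)"
      by (rule cong_nat_mod[OF r(2)]) (use b0 in simp)
    from cong_add[OF this cong_refl[of "int m"]] show ?thesis by simp
  qed
  let ?f = "\<lambda>a. nat (a + int m)"
  have gcd_eq: "gcd (r + ?f a) Q = nat \<bar>a\<bar>" if a: "a \<in> A" for a
  proof -
    let ?x = "r + ?f a"
    have x: "int ?x = a + (int r + int m)" using am[OF a] by simp
    have "[int ?x = a] (mod int (V * V))"
      unfolding x using cong_add[OF cong_refl[of a] r1] by simp
    then have "gcd (int ?x) (int (V * V)) = gcd a (int (V * V))" by (rule cong_gcd_eq)
    moreover have dvd: "nat \<bar>a\<bar> dvd V * V"
      using dvd_prodI[of G "nat \<bar>a\<bar>" "\<lambda>x. x"] G(1) a by (auto simp: V_def G_def)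
    then have "a dvd int (V * V)" by (metis abs_dvd_iff int_dvd_int_iff int_nat_eq abs_ge_zero)
    then have "gcd a (int (V * V)) = \<bar>a\<bar>" by (simp add: gcd_proj1_iff)
    ultimately have 1: "gcd ?x (V * V) = nat \<bar>a\<bar>" by (metis gcd_int_int_eq nat_int)
    have "[int ?x = a - \<alpha>] (mod int b)"
      unfolding x using cong_add[OF cong_refl[of a] r2] by simp
    then have "gcd (int ?x) (int b) = gcd (a - \<alpha>) (int b)" by (rule cong_gcd_eq)
    moreover have "coprime (nat \<bar>a - \<alpha>\<bar>) b"
      using bU a A(1) dvd_prodI[of A a "\<lambda>a. nat \<bar>a - \<alpha>\<bar>"] coprime_divisors[OF _ dvd_refl, of "nat \<bar>a - \<alpha>\<bar>" U b]
      by (auto simp: U_def coprime_commute)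
    then have "gcd (nat \<bar>a - \<alpha>\<bar>) b = 1" by (simp add: coprime_iff_gcd_eq_1)
    then have "gcd (a - \<alpha>) (int b) = 1" unfolding gcd_int_def abs_of_nat nat_int by (simp only: of_nat_1)
    ultimately have "gcd (int ?x) (int b) = 1" by (simp only:)
    then have "coprime ?x b" by (simp only: coprime_iff_gcd_eq_1[symmetric] coprime_int_iff)
    then have "gcd ?x (V * V * b) = gcd ?x (V * V)" by (rule gcd_mult_right_right_cancel)
    then show ?thesis using 1 by (simp add: Q_def)
  qed
  have "\<exists>n>0. [n = r] (mod Q) \<and> (\<forall>a\<in>?f ` A. avoids B (n + a))"
  proof (rule T; (intro ballI allI impI)?)
    show "card (?f ` A) \<le> Suc (card A)" using card_image_le[OF A(1), of ?f] by simp
    fix a' p :: nat assume "a' \<in> ?f ` A" and p: "prime p" "p \<le> T \<or> p dvd Q"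
    then obtain a where a: "a \<in> A" "a' = ?f a" by auto
    have aV: "nat \<bar>a\<bar> dvd V"
      using dvd_prodI[of G "nat \<bar>a\<bar>" "\<lambda>x. x"] G(1) a by (auto simp: V_def G_def)
    have "Q div nat \<bar>a\<bar> = V * b * (V div nat \<bar>a\<bar>)"
      using aV by (simp add: Q_def div_mult_swap ac_simps)
    moreover have "p dvd V * b"
    proof (cases "p \<le> T")
      case True
      then show ?thesis using p(1) prime_dvd_fact_iff[of p T] by (simp add: V_def)
    next
      case False
      then show ?thesis using p by (auto simp: Q_def prime_dvd_mult_iff)
    qed
    ultimately show "p dvd Q div gcd (r + a') Q" using gcd_eq[OF a(1)] a(2) by simp
  qed (use Q A(1) gcd_eq in \<open>auto simp: G_def\<close>)
  then obtain n where n: "[n = r] (mod Q)" "\<And>a. a \<in> A \<Longrightarrow> avoids B (n + ?f a)" by auto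
  show thesis
  proof (rule that[OF b(1), of "int n + int m"])
    fix a assume a: "a \<in> A"
    have "a + (int n + int m) = int (n + ?f a)" using am[OF a] by simp
    then show "a + (int n + int m) \<in> free_numbers B" using n(2)[OF a] by (simp only: free_numbers_of_nat)
  next
    have "[int n = int r] (mod int b)"
      using n(1) unfolding Q_def cong_int_iff by (rule cong_modulus_mult_nat[of _ _ b "V * V", unfolded mult.commute[of b]])
    then have "[\<alpha> + (int n + int m) = \<alpha> + (int r + int m)] (mod int b)"
      by (intro cong_add cong_refl)
    also have "[\<alpha> + (int r + int m) = \<alpha> + - \<alpha>] (mod int b)"
      by (intro cong_add cong_refl r2)
    finally show "int b dvd \<alpha> + (int n + int m)" by (simp add: cong_0_iff)
  qed
qed

section \<open>Rigidity\<close>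

definition point_of :: "int set \<Rightarrow> point" where
  "point_of A = (\<lambda>k. k \<in> A)"

lemma point_of_apply [simp]: "point_of A k \<longleftrightarrow> k \<in> A"
  by (simp add: point_of_def)

lemma shift_point_of: "shift n (point_of A) = point_of ((\<lambda>a. a - n) ` A)"
  by (force simp: fun_eq_iff shift_apply)

text \<open>
  The third condition means that \<open>B\<close> contains infinitely many pairwise coprime elements; equivalently,
  that the zero point lies in the \<open>B\<close>-free subshift.
\<close>

locale proximal_taut =
  fixes B :: "nat set"
  assumes taut: "taut B" and B_ge: "B \<subseteq> {2..}" and cop: "\<And>d. d > 0 \<Longrightarrow> \<exists>b\<in>B. coprime b d"
begin

abbreviation Y :: "point set" where
  "Y \<equiv> hereditary_closure (B_free_subshift B)"

lemma point_of_in: 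
  assumes "\<And>a. a \<in> A \<Longrightarrow> a + n \<in> free_numbers B"
  shows "point_of A \<in> Y"
  using assms by (auto simp: hereditary_closure_iff freeable_def subset_iff)

lemma freeable_support:
  assumes "x \<in> Y" "finite A" "A \<subseteq> {k. x k}"
  shows "\<exists>n. \<forall>a\<in>A. a + n \<in> free_numbers B"
  using assms unfolding hereditary_closure_iff freeable_def by blast

lemma full_not_in: "(\<lambda>_. True) \<notin> Y"
proof
  assume Y: "(\<lambda>_. True) \<in> Y"
  obtain b where b: "b \<in> B" using cop[of 1] by auto
  have "finite {0..<int b}" by simp
  from freeable_support[OF Y this] obtain n where n: "\<And>a. a \<in> {0..<int b} \<Longrightarrow> a + n \<in> free_numbers B" by blast
  have "(- n) mod int b \<in> {0..<int b}" using b B_ge by force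
  then have "(- n) mod int b + n \<in> free_numbers B" by (rule n)
  moreover have "int b dvd (- n) mod int b + n" by (simp add: mod_eq_0_iff_dvd[symmetric] mod_simps)
  ultimately show False using b by (auto simp: free_numbers_def mem_multiples_iff)
qed

text \<open>
  The offset \<open>N\<close> is the translation under which the numbers \<open>y c\<close> become free representatives of the
  nonzero classes modulo \<open>b\<close>.
\<close>

lemma spread_residues:
  fixes N L D :: int
  assumes b: "b \<in> B" and D: "D \<ge> 0"
  obtains y :: "nat \<Rightarrow> int" where
    "\<And>c. c \<in> {1..<b} \<Longrightarrow> y c + N \<in> free_numbers B"
    "\<And>c. c \<in> {1..<b} \<Longrightarrow> int b dvd y c + N - int c"
    "\<And>c. c \<in> {1..<b} \<Longrightarrow> y c > L"
    "\<And>c c'. c \<in> {1..<b} \<Longrightarrow> c' \<in> {1..<b} \<Longrightarrow> c \<noteq> c' \<Longrightarrow> \<bar>y c - y c'\<bar> > D"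
proof -
  have "\<exists>y :: nat \<Rightarrow> int. (\<forall>c\<in>{1..<k}. y c + N \<in> free_numbers B \<and> int b dvd y c + N - int c \<and> y c > L) \<and>
      (\<forall>c\<in>{1..<k}. \<forall>c'\<in>{1..<k}. c \<noteq> c' \<longrightarrow> \<bar>y c - y c'\<bar> > D)" if "k \<le> b" for k
    using that
  proof (induction k)
    case 0
    then show ?case by simp
  next
    case (Suc k)
    then obtain y :: "nat \<Rightarrow> int" where
      y: "\<And>c. c \<in> {1..<k} \<Longrightarrow> y c + N \<in> free_numbers B \<and> int b dvd y c + N - int c \<and> y c > L"
      and sep: "\<And>c c'. c \<in> {1..<k} \<Longrightarrow> c' \<in> {1..<k} \<Longrightarrow> c \<noteq> c' \<Longrightarrow> \<bar>y c - y c'\<bar> > D"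
      by fastforce
    show ?case
    proof (cases "k = 0")
      case False
      define M where "M = Max (insert L (y ` {1..<k})) + D"
      have M: "L \<le> M" "\<And>c. c \<in> {1..<k} \<Longrightarrow> y c + D \<le> M"
        unfolding M_def using D Max_ge[of "insert L (y ` {1..<k})"] by (force intro: add_increasing2)+
      have "\<not> b dvd k" using False Suc.prems by (auto dest: dvd_imp_le)
      then obtain n where n: "n > nat (\<bar>M\<bar> + \<bar>N\<bar>)" "[n = k] (mod b)" "avoids B n"
        using free_numbers_residue_class[OF taut B_ge b] by blast
      define y' where "y' = y(k := int n - N)"
      have nM: "int n - N > M" using n(1) by linarith
      have "int b dvd int n - int k" using n(2) by (simp add: cong_iff_dvd_diff flip: cong_int_iff)
      then have "y' c + N \<in> free_numbers B \<and> int b dvd y' c + N - int c \<and> y' c > L" if "c \<in> {1..<Suc k}" for c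
        using y[of c] that n(3) nM M(1) by (cases "c = k") (auto simp: y'_def)
      moreover have "\<bar>y' c - y' c'\<bar> > D" if "c \<in> {1..<Suc k}" "c' \<in> {1..<Suc k}" "c \<noteq> c'" for c c'
        using that sep[of c c'] M(2)[of c] M(2)[of c'] nM unfolding y'_def
        by (cases "c = k"; cases "c' = k") auto
      ultimately show ?thesis by blast
    qed simp
  qed
  from this[of b] show thesis using that by blast
qed

text \<open>
  Free numbers avoid the class of zero. If another translation kept all \<open>y c\<close> free without being
  congruent to \<open>N\<close>, one of the \<open>b - 1\<close> nonzero classes would be moved to zero.
\<close>

lemma residues_determine_shift:
  assumes b: "b \<in> B" and y: "\<And>c. c \<in> {1..<b} \<Longrightarrow> int b dvd y c + N - int c"
    and free: "\<And>c. c \<in> {1..<b} \<Longrightarrow> y c + m \<in> free_numbers B"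
  shows "int b dvd m - N"
proof (rule ccontr)
  assume nd: "\<not> int b dvd m - N"
  have b0: "int b > 0" using b B_ge by force
  define c where "c = nat ((N - m) mod int b)"
  have c: "int c = (N - m) mod int b" using b0 by (simp add: c_def)
  have "(N - m) mod int b \<noteq> 0"
    using nd by (simp add: mod_eq_0_iff_dvd dvd_diff_commute)
  then have "c \<noteq> 0" using c by auto
  moreover have "int c < int b" unfolding c using b0 by simp
  ultimately have cb: "c \<in> {1..<b}" by simp
  have "int b dvd int c - (N - m)"
    unfolding c by (simp add: mod_eq_dvd_iff[symmetric])
  then have "int b dvd (y c + N - int c) + (int c - (N - m))" using y[OF cb] by (intro dvd_add)
  then have "int b dvd y c + m" by (simp add: algebra_simps)
  then show False using free[OF cb] b by (auto simp: free_numbers_def mem_multiples_iff)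
qed

end

locale proximal_block_map = proximal_taut +
  fixes f :: "point \<Rightarrow> point" and r :: int
  assumes f_in: "\<And>x. x \<in> Y \<Longrightarrow> f x \<in> Y"
    and f_shift: "\<And>x n. x \<in> Y \<Longrightarrow> f (shift n x) = shift n (f x)"
    and r_nonneg: "r \<ge> 0"
    and window: "\<And>x y k. x \<in> Y \<Longrightarrow> y \<in> Y \<Longrightarrow> (\<And>i. \<bar>i - k\<bar> \<le> r \<Longrightarrow> x i = y i) \<Longrightarrow> f x k = f y k"
begin

text \<open>
  The support of the image of a single one at the origin; it turns out to have one element.
\<close>

definition S :: "int set" where
  "S = {k. f (point_of {0}) k}"

lemma one_free: "1 \<in> free_numbers B"
  using B_ge by (force simp: free_numbers_iff avoids_def)

lemma point_of_empty_in: "point_of {} \<in> Y" and point_of_singleton_in: "point_of {a} \<in> Y"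
  using point_of_in[of "{}" 0] point_of_in[of "{a}" "1 - a"] one_free by auto

lemma f_empty: "f (point_of {}) = point_of {}"
proof -
  have "shift n (point_of {}) = point_of {}" for n by (simp add: shift_point_of)
  then have const: "f (point_of {}) n = f (point_of {}) 0" for n
    using f_shift[OF point_of_empty_in, of n] by (metis add_0 shift_apply)
  have "\<not> f (point_of {}) 0"
  proof
    assume "f (point_of {}) 0"
    then have "f (point_of {}) = (\<lambda>_. True)" using const by (auto simp: fun_eq_iff)
    then show False using f_in[OF point_of_empty_in] full_not_in by simp
  qed
  then show ?thesis using const by (auto simp: fun_eq_iff)
qed

lemma f_near:
  assumes "x \<in> Y" "f x k"
  obtains i where "x i" "\<bar>i - k\<bar> \<le> r"
proof -
  have "\<not> (\<forall>i. \<bar>i - k\<bar> \<le> r \<longrightarrow> \<not> x i)"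
    using window[OF assms(1) point_of_empty_in, of k] assms(2) f_empty by auto
  then show thesis using that by auto
qed

lemma S_bound: "s \<in> S \<Longrightarrow> \<bar>s\<bar> \<le> r"
  using f_near[OF point_of_singleton_in[of 0], of s] by (auto simp: S_def)

lemma f_singleton: "f (point_of {y}) k \<longleftrightarrow> k - y \<in> S"
proof -
  have "point_of {y} = shift (- y) (point_of {0})" by (simp add: shift_point_of)
  then show ?thesis using f_shift[OF point_of_singleton_in, of "- y" 0] by (simp add: shift_apply S_def)
qed

lemma f_isolated:
  assumes x: "x \<in> Y" "x y" and iso: "\<And>i. \<bar>i - y\<bar> \<le> 2 * r \<Longrightarrow> x i \<Longrightarrow> i = y" and s: "s \<in> S"
  shows "f x (y + s)"
proof -
  have "f x (y + s) = f (point_of {y}) (y + s)"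
  proof (rule window[OF x(1) point_of_singleton_in])
    fix i assume "\<bar>i - (y + s)\<bar> \<le> r"
    then have "\<bar>i - y\<bar> \<le> 2 * r" using S_bound[OF s] by linarith
    then show "x i = point_of {y} i" using iso[of i] x(2) by auto
  qed
  then show ?thesis using s by (simp add: f_singleton)
qed

lemma two_r_nonneg: "0 \<le> 2 * r"
  using r_nonneg by simp

text \<open>
  If \<open>s\<close> and \<open>s'\<close> are in \<open>S\<close>, a sparse set \<open>C\<close> that represents the nonzero classes modulo \<open>b\<close> has an image
  whose support contains \<open>C + s\<close> and \<open>C + s'\<close>. A translation that makes the image free moves both \<open>s\<close> and
  \<open>s'\<close> to zero modulo \<open>b\<close>, so \<open>b\<close> divides \<open>s - s'\<close>; but \<open>b\<close> may be taken coprime to it.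
\<close>

lemma S_unique:
  assumes s: "s \<in> S" "s' \<in> S"
  shows "s = s'"
proof (rule ccontr)
  assume "s \<noteq> s'"
  then obtain b where b: "b \<in> B" "coprime b (nat \<bar>s - s'\<bar>)" using cop[of "nat \<bar>s - s'\<bar>"] by auto
  obtain y :: "nat \<Rightarrow> int" where
    y: "\<And>c. c \<in> {1..<b} \<Longrightarrow> y c + 0 \<in> free_numbers B"
    "\<And>c. c \<in> {1..<b} \<Longrightarrow> int b dvd y c + 0 - int c"
    "\<And>c c'. c \<in> {1..<b} \<Longrightarrow> c' \<in> {1..<b} \<Longrightarrow> c \<noteq> c' \<Longrightarrow> \<bar>y c - y c'\<bar> > 2 * r"
    using spread_residues[OF b(1) two_r_nonneg, where N = 0 and L = 0] by metis
  let ?C = "y ` {1..<b}"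
  have C: "point_of ?C \<in> Y" by (rule point_of_in[of _ 0]) (use y(1) in auto)
  have img: "f (point_of ?C) (y c + t)" if "c \<in> {1..<b}" "t \<in> S" for c t
  proof (rule f_isolated[OF C _ _ that(2)])
    show "point_of ?C (y c)" using that by auto
    fix i assume "\<bar>i - y c\<bar> \<le> 2 * r" "point_of ?C i"
    then obtain c' where c': "c' \<in> {1..<b}" "i = y c'" "\<bar>y c' - y c\<bar> \<le> 2 * r" by auto
    then show "i = y c" using y(3)[OF c'(1) that(1)] by (cases "c' = c") auto
  qed
  have sup: "(\<lambda>c. y c + s) ` {1..<b} \<union> (\<lambda>c. y c + s') ` {1..<b} \<subseteq> {k. f (point_of ?C) k}"
    using img s by auto
  obtain n where n: "\<And>a. a \<in> (\<lambda>c. y c + s) ` {1..<b} \<union> (\<lambda>c. y c + s') ` {1..<b} \<Longrightarrow> a + n \<in> free_numbers B"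
    using freeable_support[OF f_in[OF C] _ sup] by blast
  have "int b dvd (t + n) - 0" if "t \<in> {s, s'}" for t
  proof (rule residues_determine_shift[OF b(1), of y])
    show "int b dvd y c + 0 - int c" if "c \<in> {1..<b}" for c using y(2)[OF that] .
    fix c assume "c \<in> {1..<b}"
    then have "y c + t + n \<in> free_numbers B" using \<open>t \<in> {s, s'}\<close> by (intro n) auto
    then show "y c + (t + n) \<in> free_numbers B" by (simp add: add.assoc)
  qed
  then have "int b dvd (s + n) - (s' + n)" by (intro dvd_diff) auto
  then have "int b dvd s - s'" by simp
  then have "b dvd nat \<bar>s - s'\<bar>" by (simp add: int_dvd_int_iff[symmetric])
  then have "b = 1" using b(2) by (metis coprime_absorb_left nat_dvd_1_iff_1)
  then show False using b(1) B_ge by force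
qed

text \<open>
  Otherwise some \<open>N\<close> makes \<open>A\<close> free and \<open>k - s\<close> a multiple of some \<open>b \<in> B\<close>. Adjoin to \<open>A\<close> a remote sparse set
  \<open>C\<close> of numbers that become free representatives of the nonzero classes modulo \<open>b\<close> after adding \<open>N\<close>. The image of
  \<open>A \<union> C\<close> has ones at \<open>k\<close> and on \<open>C + s\<close>. A translation \<open>m\<close> that makes it free satisfies \<open>m \<equiv> N - s\<close>
  modulo \<open>b\<close>, and thus moves \<open>k\<close> to a multiple of \<open>b\<close>.
\<close>

lemma f_finite_support:
  assumes s: "s \<in> S" and A: "finite A" "point_of A \<in> Y" and k: "f (point_of A) k"
  shows "k - s \<in> A"
proof (rule ccontr)
  assume nA: "k - s \<notin> A"
  obtain n1 where n1: "\<And>a. a \<in> A \<Longrightarrow> a + n1 \<in> free_numbers B"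
    using freeable_support[OF A(2,1)] by auto
  obtain n b where b: "b \<in> B" and n: "\<And>a. a \<in> (\<lambda>a. a + n1) ` A \<Longrightarrow> a + n \<in> free_numbers B"
    and bk: "int b dvd k - s + n1 + n"
  proof (rule simultaneously_free[OF taut B_ge cop, of "(\<lambda>a. a + n1) ` A" "k - s + n1"])
    show "(\<lambda>a. a + n1) ` A \<subseteq> free_numbers B" using n1 by auto
    show "k - s + n1 \<notin> (\<lambda>a. a + n1) ` A" using nA by auto
  qed (use A(1) in auto)
  let ?N = "n1 + n"
  obtain a0 where a0: "a0 \<in> A" "\<bar>a0 - k\<bar> \<le> r" using f_near[OF A(2) k] by auto
  obtain y :: "nat \<Rightarrow> int" where
    y: "\<And>c. c \<in> {1..<b} \<Longrightarrow> y c + ?N \<in> free_numbers B"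
    "\<And>c. c \<in> {1..<b} \<Longrightarrow> int b dvd y c + ?N - int c"
    "\<And>c. c \<in> {1..<b} \<Longrightarrow> y c > Max A + 2 * r"
    "\<And>c c'. c \<in> {1..<b} \<Longrightarrow> c' \<in> {1..<b} \<Longrightarrow> c \<noteq> c' \<Longrightarrow> \<bar>y c - y c'\<bar> > 2 * r"
    using spread_residues[OF b two_r_nonneg, where N = ?N and L = "Max A + 2 * r"] by metis
  have far: "y c > a + 2 * r" if "c \<in> {1..<b}" "a \<in> A" for a c
    using y(3)[OF that(1)] Max_ge[OF A(1) that(2)] by linarith
  define x where "x = point_of (A \<union> y ` {1..<b})"
  have x: "x \<in> Y" unfolding x_def
  proof (rule point_of_in[of _ ?N])
    fix a assume "a \<in> A \<union> y ` {1..<b}"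
    then show "a + ?N \<in> free_numbers B" using n[of "a + n1"] y(1) by (auto simp: add.assoc)
  qed
  have "f x k = f (point_of A) k"
  proof (rule window[OF x A(2)])
    fix i assume "\<bar>i - k\<bar> \<le> r"
    then have "i \<le> a0 + 2 * r" using a0(2) by linarith
    then show "x i = point_of A i" using far[OF _ a0(1)] by (force simp: x_def)
  qed
  then have fk: "f x k" using k by simp
  have img: "f x (y c + s)" if "c \<in> {1..<b}" for c
  proof (rule f_isolated[OF x _ _ s])
    show "x (y c)" using that by (auto simp: x_def)
    fix i assume i: "\<bar>i - y c\<bar> \<le> 2 * r" "x i"
    have "i \<notin> A" using far[OF that, of i] i(1) by auto
    then obtain c' where c': "c' \<in> {1..<b}" "i = y c'" using i(2) by (auto simp: x_def)
    then show "i = y c" using y(4)[OF c'(1) that] i(1) by (cases "c' = c") auto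
  qed
  have sup: "insert k ((\<lambda>c. y c + s) ` {1..<b}) \<subseteq> {k. f x k}" using fk img by auto
  obtain m where m: "\<And>a. a \<in> insert k ((\<lambda>c. y c + s) ` {1..<b}) \<Longrightarrow> a + m \<in> free_numbers B"
    using freeable_support[OF f_in[OF x] _ sup] by blast
  have "int b dvd (s + m) - ?N"
  proof (rule residues_determine_shift[OF b, of y])
    show "int b dvd y c + ?N - int c" if "c \<in> {1..<b}" for c using y(2)[OF that] .
    fix c assume "c \<in> {1..<b}"
    then have "y c + s + m \<in> free_numbers B" by (intro m) auto
    then show "y c + (s + m) \<in> free_numbers B" by (simp add: add.assoc)
  qed
  then have "int b dvd ((s + m) - ?N) + (k - s + n1 + n)" using bk by (rule dvd_add)
  then have "int b dvd k + m" by (simp add: algebra_simps)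
  then show False using m[of k] b by (auto simp: free_numbers_def mem_multiples_iff)
qed

end

context proximal_taut
begin

text \<open>
  Applied to the automorphism and to its inverse, \<open>f_finite_support\<close> shows that both translate
  finite supports. Finite supports determine the map because of its finite window.
\<close>

lemma Aut_is_shift:
  assumes f: "f \<in> carrier (Aut Y)"
  shows "\<exists>n. f = restrict (shift n) Y"
proof -
  have sh: "shift n x \<in> Y" if "x \<in> Y" for n x using that by (rule hereditary_closure_shift)
  obtain g where g: "\<And>x. x \<in> Y \<Longrightarrow> f x \<in> Y" "\<And>x. x \<in> Y \<Longrightarrow> g x \<in> Y"
    "\<And>x. x \<in> Y \<Longrightarrow> g (f x) = x" "\<And>x. x \<in> Y \<Longrightarrow> f (g x) = x"
    "continuous_on Y f" "continuous_on Y g"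
    "\<And>x. x \<in> Y \<Longrightarrow> f (\<sigma> x) = \<sigma> (f x)" "\<And>x. x \<in> Y \<Longrightarrow> g (\<sigma> x) = \<sigma> (g x)"
    "f \<in> extensional Y"
  proof (rule carrier_Aut_D[OF f])
    show "\<sigma> x \<in> Y" if "x \<in> Y" for x by (rule sh[OF that])
  qed blast
  obtain p where p: "p \<ge> 0" "\<And>x y k. x \<in> Y \<Longrightarrow> y \<in> Y \<Longrightarrow> (\<And>i. \<bar>i - k\<bar> \<le> p \<Longrightarrow> x i = y i) \<Longrightarrow> f x k = f y k"
    using uniform_window[OF compact_hereditary_closure g(5) g(7) sh] by metis
  obtain q where q: "q \<ge> 0" "\<And>x y k. x \<in> Y \<Longrightarrow> y \<in> Y \<Longrightarrow> (\<And>i. \<bar>i - k\<bar> \<le> q \<Longrightarrow> x i = y i) \<Longrightarrow> g x k = g y k"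
    using uniform_window[OF compact_hereditary_closure g(6) g(8) sh] by metis
  have f_shift: "f (shift n x) = shift n (f x)" if "x \<in> Y" for x n
    by (rule commute_shift_int[where X = Y]) (use g(7) sh that in auto)
  interpret F: proximal_block_map B f p
    by unfold_locales (fact g p f_shift)+
  have g_shift: "g (shift n x) = shift n (g x)" if "x \<in> Y" for x n
    by (rule commute_shift_int[where X = Y]) (use g(8) sh that in auto)
  interpret G: proximal_block_map B g q
    by unfold_locales (fact g q g_shift)+
  have "F.S \<noteq> {}"
  proof
    assume "F.S = {}"
    then have "f (point_of {0}) = f (point_of {})" by (auto simp: F.f_empty F.f_singleton fun_eq_iff)
    then have "point_of {0} = point_of {}" using g(3) F.point_of_empty_in F.point_of_singleton_in by metis
    then show False by (auto simp: fun_eq_iff)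
  qed
  then obtain s where s: "s \<in> F.S" by auto
  then have "F.S = {s}" using F.S_unique by blast
  then have "f (point_of {0}) = point_of {s}" by (simp add: fun_eq_iff F.f_singleton)
  then have "g (point_of {s}) = point_of {0}" using g(3)[OF F.point_of_singleton_in[of 0]] by simp
  then have t: "- s \<in> G.S" using G.f_singleton[of s 0] by simp
  have fin: "f (point_of A) k \<longleftrightarrow> k - s \<in> A" if A: "finite A" "point_of A \<in> Y" for A k
  proof
    assume "f (point_of A) k"
    then show "k - s \<in> A" using F.f_finite_support[OF s A] by simp
  next
    assume k: "k - s \<in> A"
    define A' where "A' = {k. f (point_of A) k}"
    have fA: "f (point_of A) = point_of A'" by (auto simp: A'_def fun_eq_iff)
    have "A' \<subseteq> (\<lambda>a. a + s) ` A"
      using F.f_finite_support[OF s A] by (force simp: A'_def)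
    then have "finite A'" using A(1) finite_subset by blast
    moreover have "point_of A' \<in> Y" using g(1)[OF A(2)] fA by simp
    moreover have "g (point_of A') (k - s)" using g(3)[OF A(2)] fA k by simp
    ultimately have "k - s - (- s) \<in> A'" by (rule G.f_finite_support[OF t])
    then show "f (point_of A) k" by (simp add: A'_def)
  qed
  have "f x k = x (k - s)" if x: "x \<in> Y" for x k
  proof -
    define A where "A = {i. x i \<and> \<bar>i - k\<bar> \<le> p + \<bar>s\<bar>}"
    have "A \<subseteq> {k - (p + \<bar>s\<bar>)..k + (p + \<bar>s\<bar>)}" by (auto simp: A_def)
    then have A: "finite A" "point_of A \<in> Y"
      using hereditary_closure_mono[OF x, of "point_of A"] finite_subset by (auto simp: A_def)
    have "f x k = f (point_of A) k" by (rule p(2)[OF x A(2)]) (auto simp: A_def)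
    also have "\<dots> \<longleftrightarrow> x (k - s)" using fin[OF A] p(1) by (simp add: A_def)
    finally show ?thesis .
  qed
  then have "f x = restrict (shift (- s)) Y x" for x
    using g(9) by (cases "x \<in> Y") (auto simp: fun_eq_iff shift_apply extensional_def)
  then have "f = restrict (shift (- s)) Y" by (rule ext)
  then show ?thesis by blast
qed

theorem trivial_Aut_hereditary_closure: "trivial_Aut Y"
  unfolding trivial_Aut_def
  using Aut_is_shift shift_in_Aut[of Y] hereditary_closure_shift by blast

end

section \<open>The dichotomy\<close>

theorem corollary1p1:
  fixes B :: "nat set"
  assumes "B \<subseteq> {2..}" and "taut B"
  shows "(\<exists>h. h \<in> mon (Aut UNIV) (Aut (hereditary_closure (B_free_subshift B)))) \<or>
         trivial_Aut (hereditary_closure (B_free_subshift B))"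
proof (cases "\<exists>d>0. \<forall>b\<in>B. \<not> coprime b d")
  case True
  then show ?thesis using Aut_full_shift_embeds[OF assms(1)] by blast
next
  case False
  then interpret proximal_taut B
    by unfold_locales (use assms in blast)+
  show ?thesis using trivial_Aut_hereditary_closure by blast
qed

end
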